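(* Let $\mathfrak g$ be a (finite-dimensional, real, even-dimensional) unimodular Lie algebra which contains an abelian ideal $\mathfrak a$ of codimension $2$, and let $J$ be a complex structure on $\mathfrak g$ satisfying $J\mathfrak a\neq\mathfrak a$. If $(\mathfrak g,J)$ admits a compatible balanced metric and a compatible pluriclosed metric (possibly different from each other), then $(\mathfrak g,J)$ admits a compatible Kähler metric.
   Context: Let $\mathfrak g$ be a real Lie algebra of dimension $2n$. It is unimodular if $\mathrm{tr}(\mathrm{ad}_x)=0$ for all $x\in\mathfrak g$. A complex structure on $\mathfrak g$ is a linear map $J:\mathfrak g\to\mathfrak g$ with $J^2=-I$ and $[x,y]-[Jx,Jy]+J[Jx,y]+J[x,Jy]=0$ for all $x,y\in\mathfrak g$. A metric compatible with $J$ is an inner product $g$ on $\mathfrak g$ with $g(Jx,Jy)=g(x,y)$; its Kähler form is $\omega(x,y)=g(Jx,y)$. Let $d$ be the Chevalley–Eilenberg differential on $\Lambda^\bullet\mathfrak g^*\otimes\mathbb C$ (equivalently, the exterior differential on left-invariant forms on a Lie group with Lie algebra $\mathfrak g$); by integrability of $J$ it splits as $d=\partial+\overline\partial$ with respect to the bidegree defined by $J$. The metric $g$ is balanced if $d(\omega^{n-1})=0$, pluriclosed if $\partial\overline\partial\omega=0$, and Kähler if $d\omega=0$. The assertion that the Fino–Vezzoni Conjecture holds for $(\mathfrak g,J)$ means: if $(\mathfrak g,J)$ admits a compatible balanced metric and a compatible pluriclosed metric, then it admits a compatible Kähler metric. *)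

theory Defs
  imports "HOL-Analysis.Analysis" "HOL-Combinatorics.Permutations"
begin

text \<open>A real Lie algebra of positive finite dimension is a bracket on a type of class
  \<^class>\<open>euclidean_space\<close>.  Only the vector space structure of that class is used; its own inner
  product occurs just in the formula for the trace, which does not depend on it.\<close>

locale lie_algebra =
  fixes br :: "'a::euclidean_space \<Rightarrow> 'a \<Rightarrow> 'a"
  assumes bilinear_bracket: "bilinear br"
    and bracket_self: "br x x = 0"
    and jacobi: "br x (br y z) + br y (br z x) + br z (br x y) = 0"

definition endo_trace :: "('a::euclidean_space \<Rightarrow> 'a) \<Rightarrow> real"
  where "endo_trace f = (\<Sum>b\<in>Basis. f b \<bullet> b)"

definition unimodular :: "('a::euclidean_space \<Rightarrow> 'a \<Rightarrow> 'a) \<Rightarrow> bool"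
  where "unimodular br \<longleftrightarrow> (\<forall>x. endo_trace (br x) = 0)"

definition lie_ideal :: "('a::euclidean_space \<Rightarrow> 'a \<Rightarrow> 'a) \<Rightarrow> 'a set \<Rightarrow> bool"
  where "lie_ideal br I \<longleftrightarrow> subspace I \<and> (\<forall>x. \<forall>y\<in>I. br x y \<in> I)"

definition abelian_on :: "('a::euclidean_space \<Rightarrow> 'a \<Rightarrow> 'a) \<Rightarrow> 'a set \<Rightarrow> bool"
  where "abelian_on br I \<longleftrightarrow> (\<forall>x\<in>I. \<forall>y\<in>I. br x y = 0)"

definition complex_structure :: "('a::euclidean_space \<Rightarrow> 'a \<Rightarrow> 'a) \<Rightarrow> ('a \<Rightarrow> 'a) \<Rightarrow> bool"
  where "complex_structure br J \<longleftrightarrow>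
    linear J \<and> (\<forall>x. J (J x) = - x) \<and>
    (\<forall>x y. br x y - br (J x) (J y) + J (br (J x) y) + J (br x (J y)) = 0)"

definition compatible_metric :: "('a::euclidean_space \<Rightarrow> 'a) \<Rightarrow> ('a \<Rightarrow> 'a \<Rightarrow> real) \<Rightarrow> bool"
  where "compatible_metric J g \<longleftrightarrow>
    bilinear g \<and> (\<forall>x y. g x y = g y x) \<and> (\<forall>x. x \<noteq> 0 \<longrightarrow> g x x > 0) \<and>
    (\<forall>x y. g (J x) (J y) = g x y)"

text \<open>An element of the full complexified exterior algebra is encoded as a function on lists of
  vectors: its values on lists of length \<open>k\<close> are those of its component of degree \<open>k\<close>.  Thus a
  homogeneous form of degree \<open>k\<close> vanishes on lists of any other length.\<close>

type_synonym 'a form = "'a list \<Rightarrow> complex"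

definition unit_form :: "'a form"
  where "unit_form xs = (if xs = [] then 1 else 0)"

text \<open>For \<open>\<alpha>\<close> of degree \<open>p\<close> and \<open>\<beta>\<close> of degree \<open>q\<close> only one summand of the outer sum survives.\<close>

definition wedge :: "'a form \<Rightarrow> 'a form \<Rightarrow> 'a form"
  where "wedge \<alpha> \<beta> xs =
    (\<Sum>p\<le>length xs. (\<Sum>\<sigma> | \<sigma> permutes {..<length xs}.
        of_int (sign \<sigma>) * \<alpha> (take p (permute_list \<sigma> xs)) * \<beta> (drop p (permute_list \<sigma> xs)))
      / (fact p * fact (length xs - p)))"

primrec wedge_power :: "'a form \<Rightarrow> nat \<Rightarrow> 'a form"
  where
    "wedge_power \<alpha> 0 = unit_form"
  | "wedge_power \<alpha> (Suc k) = wedge \<alpha> (wedge_power \<alpha> k)"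

text \<open>The Chevalley--Eilenberg differential
  \<open>d\<alpha>(x\<^sub>0,\<dots>,x\<^sub>k) = \<Sum>i<j. (-1)\<^sup>i\<^sup>+\<^sup>j \<alpha>([x\<^sub>i,x\<^sub>j],x\<^sub>0,\<dots>,x\<^sub>k)\<close>, with \<open>x\<^sub>i\<close> and \<open>x\<^sub>j\<close> left out on the right.\<close>

definition ce_d :: "('a \<Rightarrow> 'a \<Rightarrow> 'a) \<Rightarrow> 'a form \<Rightarrow> 'a form"
  where "ce_d br \<alpha> xs =
    (\<Sum>j<length xs. \<Sum>i<j. (-1) ^ (i + j) * \<alpha> (br (xs ! i) (xs ! j) # nths xs (- {i, j})))"

text \<open>The complexified Lie algebra is represented by pairs, \<open>(x, y)\<close> standing for \<open>x + \<i>y\<close>, and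
  \<open>cext \<alpha>\<close> is the complex multilinear extension of \<open>\<alpha>\<close> to it.\<close>

fun cext :: "'a form \<Rightarrow> ('a \<times> 'a) form"
  where
    "cext \<alpha> [] = \<alpha> []"
  | "cext \<alpha> (z # zs) =
       cext (\<lambda>ys. \<alpha> (fst z # ys)) zs + \<i> * cext (\<lambda>ys. \<alpha> (snd z # ys)) zs"

text \<open>The components \<open>(x - \<i>Jx)/2\<close> and \<open>(x + \<i>Jx)/2\<close> of a real vector in the \<open>\<plusminus>\<i>\<close>-eigenspaces
  of \<open>J\<close>.\<close>

definition part10 :: "('a::real_vector \<Rightarrow> 'a) \<Rightarrow> 'a \<Rightarrow> 'a \<times> 'a"
  where "part10 J x = (x /\<^sub>R 2, - (J x /\<^sub>R 2))"

definition part01 :: "('a::real_vector \<Rightarrow> 'a) \<Rightarrow> 'a \<Rightarrow> 'a \<times> 'a"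
  where "part01 J x = (x /\<^sub>R 2, J x /\<^sub>R 2)"

text \<open>The component of bidegree \<open>(p, q)\<close>: the part of \<open>\<alpha>\<close> that takes \<open>p\<close> arguments of type
  \<open>(1, 0)\<close> and \<open>q\<close> arguments of type \<open>(0, 1)\<close>.\<close>

definition bidegree_part :: "('a::real_vector \<Rightarrow> 'a) \<Rightarrow> nat \<Rightarrow> nat \<Rightarrow> 'a form \<Rightarrow> 'a form"
  where "bidegree_part J p q \<alpha> xs =
    (if length xs = p + q
     then \<Sum>S | S \<subseteq> {..<length xs} \<and> card S = p.
            cext \<alpha> (map (\<lambda>i. if i \<in> S then part10 J (xs ! i) else part01 J (xs ! i)) [0..<length xs])
     else 0)"

text \<open>The operators of bidegree \<open>(1, 0)\<close> and \<open>(0, 1)\<close> induced by the differential, summed over all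
  bidegrees \<open>(p, q)\<close> of the argument; only those with \<open>p + q + 1 = length xs\<close> contribute.\<close>

definition del :: "('a::real_vector \<Rightarrow> 'a \<Rightarrow> 'a) \<Rightarrow> ('a \<Rightarrow> 'a) \<Rightarrow> 'a form \<Rightarrow> 'a form"
  where "del br J \<alpha> xs =
    (\<Sum>p<length xs. \<Sum>q<length xs.
      bidegree_part J (Suc p) q (ce_d br (bidegree_part J p q \<alpha>)) xs)"

definition delbar :: "('a::real_vector \<Rightarrow> 'a \<Rightarrow> 'a) \<Rightarrow> ('a \<Rightarrow> 'a) \<Rightarrow> 'a form \<Rightarrow> 'a form"
  where "delbar br J \<alpha> xs =
    (\<Sum>p<length xs. \<Sum>q<length xs.
      bidegree_part J p (Suc q) (ce_d br (bidegree_part J p q \<alpha>)) xs)"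

definition kaehler_form :: "('a \<Rightarrow> 'a) \<Rightarrow> ('a \<Rightarrow> 'a \<Rightarrow> real) \<Rightarrow> 'a form"
  where "kaehler_form J g xs = (case xs of [x, y] \<Rightarrow> complex_of_real (g (J x) y) | _ \<Rightarrow> 0)"

definition balanced ::
    "('a::euclidean_space \<Rightarrow> 'a \<Rightarrow> 'a) \<Rightarrow> ('a \<Rightarrow> 'a) \<Rightarrow> ('a \<Rightarrow> 'a \<Rightarrow> real) \<Rightarrow> bool"
  where "balanced br J g \<longleftrightarrow>
    ce_d br (wedge_power (kaehler_form J g) (DIM('a) div 2 - 1)) = (\<lambda>_. 0)"

definition pluriclosed ::
    "('a::euclidean_space \<Rightarrow> 'a \<Rightarrow> 'a) \<Rightarrow> ('a \<Rightarrow> 'a) \<Rightarrow> ('a \<Rightarrow> 'a \<Rightarrow> real) \<Rightarrow> bool"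
  where "pluriclosed br J g \<longleftrightarrow> del br J (delbar br J (kaehler_form J g)) = (\<lambda>_. 0)"

definition kaehler ::
    "('a::euclidean_space \<Rightarrow> 'a \<Rightarrow> 'a) \<Rightarrow> ('a \<Rightarrow> 'a) \<Rightarrow> ('a \<Rightarrow> 'a \<Rightarrow> real) \<Rightarrow> bool"
  where "kaehler br J g \<longleftrightarrow> ce_d br (kaehler_form J g) = (\<lambda>_. 0)"

end

theory Submission
  imports Defs
begin

text \<open>Let \<open>W = \<aa> \<inter> J\<aa>\<close> and pick \<open>u, v \<in> \<aa>\<close> spanning \<open>\<aa>\<close> modulo \<open>W\<close>, so that \<open>u, v, Ju, Jv\<close> span the whole
  algebra modulo \<open>W\<close>.  For \<open>x \<in> \<aa>\<close> the operator \<open>ad (Jx)\<close> preserves \<open>W\<close> and commutes with \<open>J\<close> there.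
  In the unimodular case a balanced metric means that \<open>[e, Je]\<close> sums to \<open>0\<close> over a unitary basis; for \<open>u, v\<close>
  orthonormal and orthogonal to \<open>W\<close>, and \<open>t\<close> the inner product of \<open>Ju\<close> and \<open>v\<close>, this reads
  \<open>[Ju, u] + [Jv, v] + t [Ju, Jv] = 0\<close>, and hence \<open>[Ju, u] + [Jv, v] \<in> W\<close>.

  Taking the trace over \<open>W\<close> of the pluriclosed equation on \<open>(x, Jx, w, Jw)\<close>, and adding \<open>x = u\<close> and \<open>x = v\<close>,
  shows that \<open>ad (Ju)\<close> and \<open>ad (Jv)\<close> are skew on \<open>W\<close>.  Unimodularity and the Jacobi identity then
  force all brackets into \<open>W\<close>.  The two operators commute, so a change of \<open>u\<close> and \<open>v\<close> modulo \<open>W\<close> moves the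
  brackets among \<open>u, v, Ju, Jv\<close> into the common kernel of the two operators.  There the pluriclosed equation on
  \<open>(u, Ju, v, Jv)\<close> together with the balanced relation, where \<open>t\<^sup>2 < 1\<close>, makes all of them vanish.
  Making \<open>u, v, Ju, Jv\<close> orthonormal and orthogonal to \<open>W\<close>, while keeping the pluriclosed metric on \<open>W\<close>, gives a
  Kaehler metric.\<close>

section \<open>Powers of a two-form\<close>

text \<open>For skew \<open>\<omega>\<close> this is \<open>2 ^ k * fact k\<close> times the
  Pfaffian of the matrix with entries \<open>\<omega> [f i, f j]\<close>. Keeping all permutations,
  without choosing representatives of the pairings, makes reindexing easy.\<close>

definition pairing_sum :: "('a form) \<Rightarrow> nat \<Rightarrow> (nat \<Rightarrow> 'a) \<Rightarrow> complex"
  where "pairing_sum \<omega> k f =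
    (\<Sum>\<sigma> | \<sigma> permutes {..<2 * k}. of_int (sign \<sigma>) * (\<Prod>i<k. \<omega> [f (\<sigma> (2 * i)), f (\<sigma> (2 * i + 1))]))"

text \<open>Embeds the permutations of \<open>2 * k\<close> points as those of
  \<open>2 * Suc k\<close> points that fix \<open>0\<close> and \<open>1\<close>. Conjugation with
  an injective shift keeps the sign.\<close>

lemma shift_permutation:
  fixes k :: nat
  assumes "\<tau> permutes {..<2 * k}"
  defines "\<tau>' \<equiv> map_permutation {..<2 * k} (\<lambda>i. i + 2) \<tau>"
  shows "\<tau>' permutes {2..<2 * Suc k}" and "\<tau>' permutes {..<2 * Suc k}" and "sign \<tau>' = sign \<tau>"
    and "i < 2 * k \<Longrightarrow> \<tau>' (i + 2) = \<tau> i + 2" and "\<tau>' 0 = 0" and "\<tau>' 1 = 1"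
proof -
  have inj: "inj_on (\<lambda>i::nat. i + 2) {..<2 * k}" by (auto simp: inj_on_def)
  have "(\<lambda>i::nat. i + 2) ` {..<2 * k} = {2..<2 * Suc k}"
    using image_add_atLeastLessThan'[of 2 0 "2 * k"] by (simp add: lessThan_atLeast0 ac_simps numeral_2_eq_2)
  with inj have bij: "bij_betw (\<lambda>i::nat. i + 2) {..<2 * k} {2..<2 * Suc k}"
    by (auto simp: bij_betw_def)
  show 1: "\<tau>' permutes {2..<2 * Suc k}"
    unfolding \<tau>'_def by (rule map_permutation_permutes[OF bij assms(1)])
  then show "\<tau>' permutes {..<2 * Suc k}" by (rule permutes_subset) auto
  show "sign \<tau>' = sign \<tau>" unfolding \<tau>'_def by (rule sign_map_permutation[OF inj assms(1)]) auto
  show "i < 2 * k \<Longrightarrow> \<tau>' (i + 2) = \<tau> i + 2"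
    unfolding \<tau>'_def by (subst map_permutation_apply[OF inj]) auto
  show "\<tau>' 0 = 0" "\<tau>' 1 = 1" using permutes_not_in[OF 1] by auto
qed

text \<open>Since \<open>\<omega>\<close> has degree two, only the splitting after two arguments
  survives in \<open>wedge\<close>. The permutation from the induction hypothesis, shifted by two,
  is absorbed into the outer one; the resulting \<open>fact (2 * k)\<close> equal sums cancel the
  normalisation of \<open>wedge\<close> up to a factor two.\<close>

lemma wedge_power_pairing_sum:
  assumes deg: "\<And>xs. length xs \<noteq> 2 \<Longrightarrow> \<omega> xs = 0"
  shows "wedge_power \<omega> k xs = (if length xs = 2 * k then pairing_sum \<omega> k ((!) xs) / 2 ^ k else 0)"
proof (induction k arbitrary: xs)
  case 0
  then show ?case by (simp add: unit_form_def pairing_sum_def)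
next
  case (Suc k)
  define n where "n = length xs"
  let ?T = "\<lambda>p. (\<Sum>\<sigma> | \<sigma> permutes {..<n}. of_int (sign \<sigma>) * \<omega> (take p (permute_list \<sigma> xs)) *
      wedge_power \<omega> k (drop p (permute_list \<sigma> xs))) / (fact p * fact (n - p))"
  have W: "wedge_power \<omega> (Suc k) xs = (\<Sum>p\<le>n. ?T p)"
    by (simp add: wedge_def n_def)
  have z: "?T p = 0" if "p \<le> n" "p \<noteq> 2 \<or> n \<noteq> 2 * Suc k" for p
    using that by (auto simp: Suc.IH deg n_def intro!: sum.neutral)
  show ?case
  proof (cases "n = 2 * Suc k")
    case False
    then have "(\<Sum>p\<le>n. ?T p) = 0" by (intro sum.neutral) (use z in auto)
    then show ?thesis using False W n_def by simp
  next
    case True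
    have "(\<Sum>p\<le>n. ?T p) = (\<Sum>p\<in>{2}. ?T p)"
      by (rule sum.mono_neutral_right) (use True z in auto)
    also have "\<dots> = ?T 2" by simp
    also have "(\<Sum>\<sigma> | \<sigma> permutes {..<n}. of_int (sign \<sigma>) * \<omega> (take 2 (permute_list \<sigma> xs)) *
        wedge_power \<omega> k (drop 2 (permute_list \<sigma> xs))) =
      (\<Sum>\<sigma> | \<sigma> permutes {..<n}. \<Sum>\<tau> | \<tau> permutes {..<2 * k}. of_int (sign (\<sigma> \<circ> map_permutation {..<2 * k} (\<lambda>i. i + 2) \<tau>)) *
        (\<Prod>i<Suc k. \<omega> [xs ! ((\<sigma> \<circ> map_permutation {..<2 * k} (\<lambda>i. i + 2) \<tau>) (2 * i)), xs ! ((\<sigma> \<circ> map_permutation {..<2 * k} (\<lambda>i. i + 2) \<tau>) (2 * i + 1))]) / 2 ^ k)"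
    proof (rule sum.cong[OF refl], goal_cases)
      case (1 \<sigma>)
      then have s: "\<sigma> permutes {..<n}" by simp
      have t2: "take 2 (permute_list \<sigma> xs) = [xs ! \<sigma> 0, xs ! \<sigma> 1]"
        using True by (simp add: permute_list_def n_def upt_conv_Cons numeral_2_eq_2 del: upt_Suc)
      have d2: "drop 2 (permute_list \<sigma> xs) ! j = xs ! \<sigma> (j + 2)" if "j < 2 * k" for j
        using True that permute_list_nth[OF s[unfolded n_def], of "j + 2"] by (simp add: n_def add.commute)
      have "of_int (sign \<sigma>) * \<omega> (take 2 (permute_list \<sigma> xs)) * wedge_power \<omega> k (drop 2 (permute_list \<sigma> xs))
         = of_int (sign \<sigma>) * \<omega> [xs ! \<sigma> 0, xs ! \<sigma> 1] * pairing_sum \<omega> k ((!) (drop 2 (permute_list \<sigma> xs))) / 2 ^ k"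
        using True t2 by (simp add: Suc.IH n_def)
      also have "\<dots> = (\<Sum>\<tau> | \<tau> permutes {..<2 * k}. of_int (sign \<sigma>) * \<omega> [xs ! \<sigma> 0, xs ! \<sigma> 1] * (of_int (sign \<tau>) *
         (\<Prod>i<k. \<omega> [drop 2 (permute_list \<sigma> xs) ! \<tau> (2 * i), drop 2 (permute_list \<sigma> xs) ! \<tau> (2 * i + 1)])) / 2 ^ k)"
        by (simp only: pairing_sum_def sum_distrib_left sum_divide_distrib)
      also have "\<dots> = (\<Sum>\<tau> | \<tau> permutes {..<2 * k}. of_int (sign (\<sigma> \<circ> map_permutation {..<2 * k} (\<lambda>i. i + 2) \<tau>)) *
        (\<Prod>i<Suc k. \<omega> [xs ! ((\<sigma> \<circ> map_permutation {..<2 * k} (\<lambda>i. i + 2) \<tau>) (2 * i)), xs ! ((\<sigma> \<circ> map_permutation {..<2 * k} (\<lambda>i. i + 2) \<tau>) (2 * i + 1))]) / 2 ^ k)"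
      proof (rule sum.cong[OF refl], goal_cases)
        case (1 \<tau>)
        then have t: "\<tau> permutes {..<2 * k}" by simp
        note sh = shift_permutation[OF t]
        have tl: "\<tau> j < 2 * k" if "j < 2 * k" for j
          using permutes_in_image[OF t, of j] that by simp
        have "sign (\<sigma> \<circ> map_permutation {..<2 * k} (\<lambda>i. i + 2) \<tau>) = sign \<sigma> * sign \<tau>"
          using s sh(2,3) by (subst sign_compose) (auto intro: permutation_permutes[THEN iffD2])
        moreover have "(\<Prod>i<Suc k. \<omega> [xs ! ((\<sigma> \<circ> map_permutation {..<2 * k} (\<lambda>i. i + 2) \<tau>) (2 * i)), xs ! ((\<sigma> \<circ> map_permutation {..<2 * k} (\<lambda>i. i + 2) \<tau>) (2 * i + 1))])
          = \<omega> [xs ! \<sigma> 0, xs ! \<sigma> 1] * (\<Prod>i<k. \<omega> [drop 2 (permute_list \<sigma> xs) ! \<tau> (2 * i), drop 2 (permute_list \<sigma> xs) ! \<tau> (2 * i + 1)])"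
          unfolding prod.lessThan_Suc_shift
          using sh(4)[of "2 * _"] sh(4)[of "2 * _ + 1"] sh(5,6)
          by (auto simp: d2 tl intro!: prod.cong)
        ultimately show ?case by simp
      qed
      finally show ?case .
    qed
    also have "\<dots> = (\<Sum>\<tau> | \<tau> permutes {..<2 * k}. \<Sum>\<sigma> | \<sigma> permutes {..<n}. of_int (sign (\<sigma> \<circ> map_permutation {..<2 * k} (\<lambda>i. i + 2) \<tau>)) *
        (\<Prod>i<Suc k. \<omega> [xs ! ((\<sigma> \<circ> map_permutation {..<2 * k} (\<lambda>i. i + 2) \<tau>) (2 * i)), xs ! ((\<sigma> \<circ> map_permutation {..<2 * k} (\<lambda>i. i + 2) \<tau>) (2 * i + 1))]) / 2 ^ k)"
      by (rule sum.swap)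
    \<comment> \<open>For fixed \<open>\<tau>\<close>, right multiplication by its shift permutes
      the index set of the sum over \<open>\<sigma>\<close>, so the inner sum does not depend on
      \<open>\<tau>\<close>.\<close>
    also have "\<dots> = (\<Sum>\<tau> | \<tau> permutes {..<2 * k}. pairing_sum \<omega> (Suc k) ((!) xs) / 2 ^ k)"
    proof (rule sum.cong[OF refl], goal_cases)
      case (1 \<tau>)
      then have "map_permutation {..<2 * k} (\<lambda>i. i + 2) \<tau> permutes {..<2 * Suc k}"
        using shift_permutation(2) by blast
      from sum_permutations_compose_right[OF this, symmetric, of "\<lambda>\<sigma>. of_int (sign \<sigma>) *
          (\<Prod>i<Suc k. \<omega> [xs ! \<sigma> (2 * i), xs ! \<sigma> (2 * i + 1)]) / 2 ^ k"] show ?case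
        unfolding True pairing_sum_def sum_divide_distrib .
    qed
    also have "\<dots> = fact (2 * k) * pairing_sum \<omega> (Suc k) ((!) xs) / 2 ^ k"
      by (simp add: card_permutations)
    finally show ?thesis using W True by (simp add: n_def)
  qed
qed

text \<open>Substitute \<open>\<sigma> \<circ> \<tau>\<close> for \<open>\<sigma>\<close>. For a
  symmetry \<open>\<tau>\<close> of \<open>F\<close>, the positions \<open>p\<close> and
  \<open>\<tau> p\<close> thus carry the value \<open>r\<close> with the same total weight.\<close>

lemma permutation_sum_reindex:
  fixes F :: "('b \<Rightarrow> 'b) \<Rightarrow> 'c::comm_monoid_add"
  assumes "\<tau> permutes S" and "\<And>\<sigma>. \<sigma> permutes S \<Longrightarrow> F (\<sigma> \<circ> \<tau>) = F \<sigma>"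
  shows "(\<Sum>\<sigma> | \<sigma> permutes S. if \<sigma> p = r then F \<sigma> else 0) = (\<Sum>\<sigma> | \<sigma> permutes S. if \<sigma> (\<tau> p) = r then F \<sigma> else 0)"
  by (subst sum_permutations_compose_right[OF assms(1)]) (auto intro!: sum.cong simp: assms(2))

text \<open>Expansion of a Pfaffian along its first row, whose only possibly nonzero entry is the
  one with \<open>f 1\<close>. The factor \<open>2 * Suc k\<close> counts the positions at which a
  permutation can place the index \<open>0\<close>.\<close>

lemma pairing_sum_contract:
  assumes skew: "\<And>x y. \<omega> [x, y] = - \<omega> [y, x]"
    and orth: "\<And>j. 2 \<le> j \<Longrightarrow> j < 2 * Suc k \<Longrightarrow> \<omega> [f 0, f j] = 0"
  shows "pairing_sum \<omega> (Suc k) f = of_nat (2 * Suc k) * \<omega> [f 0, f 1] * pairing_sum \<omega> k (\<lambda>i. f (i + 2))"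
proof -
  let ?S = "{..<2 * Suc k}"
  define F where "F \<sigma> = of_int (sign \<sigma>) * (\<Prod>i<Suc k. \<omega> [f (\<sigma> (2 * i)), f (\<sigma> (2 * i + 1))])"
    for \<sigma> :: "nat \<Rightarrow> nat"
  \<comment> \<open>\<open>G q\<close> collects the permutations that place the index
    \<open>0\<close> at position \<open>q\<close>; all of them turn out to be equal.\<close>
  define G where "G q = (\<Sum>\<sigma> | \<sigma> permutes ?S. if \<sigma> q = 0 then F \<sigma> else 0)" for q
  have sg: "sign (\<sigma> \<circ> \<tau>) = sign \<sigma> * sign \<tau>" if "\<sigma> permutes ?S" "\<tau> permutes ?S" for \<sigma> \<tau> :: "nat \<Rightarrow> nat"
    using that by (intro sign_compose) (auto intro: permutation_permutes[THEN iffD2])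
  \<comment> \<open>Swapping the two positions of the first pair changes the sign of the permutation
    and, by skewness, that of one factor.\<close>
  have G1: "G 1 = G 0"
  proof -
    let ?t = "Transposition.transpose 0 1 :: nat \<Rightarrow> nat"
    have t: "?t permutes ?S" by (rule permutes_swap_id) auto
    have "F (\<sigma> \<circ> ?t) = F \<sigma>" if "\<sigma> permutes ?S" for \<sigma>
      unfolding F_def sg[OF that t] prod.lessThan_Suc_shift
      by (subst skew) (simp add: sign_swap_id Transposition.transpose_def)
    from permutation_sum_reindex[where F = F, OF t this, of 1 0] show ?thesis by (simp add: G_def)
  qed
  \<comment> \<open>Exchanging pair number \<open>i\<close> with the first pair is a product of two
    transpositions (trivial if \<open>i = 0\<close>), hence even, and only reorders the
    product.\<close>
  have Gi: "G (2 * i) = G 0" "G (2 * i + 1) = G 1" if i: "i < Suc k" for i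
  proof -
    let ?t = "Transposition.transpose 0 (2 * i) \<circ> Transposition.transpose 1 (2 * i + 1)"
    have t0: "Transposition.transpose 0 (2 * i) permutes ?S" "Transposition.transpose 1 (2 * i + 1) permutes ?S"
      using i by (auto intro!: permutes_swap_id)
    then have t: "?t permutes ?S" by (simp add: permutes_compose)
    have st: "sign ?t = 1" using t0 by (subst sg) (auto simp: sign_swap_id)
    have te: "?t (2 * j) = 2 * Transposition.transpose 0 i j" "?t (2 * j + 1) = 2 * Transposition.transpose 0 i j + 1" for j
      by (auto simp: Transposition.transpose_def) presburger
    have "F (\<sigma> \<circ> ?t) = F \<sigma>" if "\<sigma> permutes ?S" for \<sigma>
    proof -
      have "(\<Prod>j<Suc k. \<omega> [f ((\<sigma> \<circ> ?t) (2 * j)), f ((\<sigma> \<circ> ?t) (2 * j + 1))])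
        = (\<Prod>j<Suc k. \<omega> [f (\<sigma> (2 * Transposition.transpose 0 i j)), f (\<sigma> (2 * Transposition.transpose 0 i j + 1))])"
        unfolding o_apply[of \<sigma> ?t] te ..
      also have "\<dots> = (\<Prod>j<Suc k. \<omega> [f (\<sigma> (2 * j)), f (\<sigma> (2 * j + 1))])"
        using prod.permute[OF permutes_swap_id[of 0 "{..<Suc k}" i], of "\<lambda>j. \<omega> [f (\<sigma> (2 * j)), f (\<sigma> (2 * j + 1))]"] i
        by (simp add: o_def)
      finally show ?thesis unfolding F_def sg[OF that t] st by simp
    qed
    note r = permutation_sum_reindex[where F = F, OF t this, of _ 0]
    show "G (2 * i) = G 0" using r[of 0] te(1)[of 0] by (simp add: G_def)
    show "G (2 * i + 1) = G 1" using r[of 1] te(2)[of 0] by (simp add: G_def)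
  qed
  have "pairing_sum \<omega> (Suc k) f = (\<Sum>\<sigma> | \<sigma> permutes ?S. \<Sum>q\<in>?S. if \<sigma> q = 0 then F \<sigma> else 0)"
    unfolding pairing_sum_def F_def[symmetric]
  proof (rule sum.cong[OF refl], goal_cases)
    case (1 \<sigma>)
    then have s: "\<sigma> permutes ?S" by simp
    then have "\<sigma> q = 0 \<longleftrightarrow> q = inv \<sigma> 0" for q by (metis permutes_inverses)
    moreover have "inv \<sigma> 0 \<in> ?S" using permutes_in_image[OF permutes_inv[OF s], of 0] by simp
    ultimately show ?case by simp
  qed
  also have "\<dots> = (\<Sum>q\<in>?S. G q)" unfolding G_def by (rule sum.swap)
  also have "\<dots> = (\<Sum>q\<in>?S. G 0)"
  proof (rule sum.cong[OF refl])
    fix q assume "q \<in> ?S"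
    then have "q div 2 < Suc k" by auto
    from Gi[OF this] G1 show "G q = G 0" by (cases "even q") (auto elim!: evenE oddE)
  qed
  also have "\<dots> = of_nat (2 * Suc k) * G 0" by simp
  \<comment> \<open>If \<open>\<sigma> 0 = 0\<close>, the first factor is
    \<open>\<omega> [f 0, f (\<sigma> 1)]\<close>, which \<open>orth\<close> kills unless
    \<open>\<sigma> 1 = 1\<close>.\<close>
  also have "G 0 = (\<Sum>\<sigma> | \<sigma> permutes {2..<2 * Suc k}. F \<sigma>)"
    unfolding G_def
  proof (rule sum.mono_neutral_cong_right)
    show "\<forall>\<sigma>\<in>{\<sigma>. \<sigma> permutes ?S} - {\<sigma>. \<sigma> permutes {2..<2 * Suc k}}. (if \<sigma> 0 = 0 then F \<sigma> else 0) = 0"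
    proof (rule ballI)
      fix \<sigma> :: "nat \<Rightarrow> nat" assume "\<sigma> \<in> {\<sigma>. \<sigma> permutes ?S} - {\<sigma>. \<sigma> permutes {2..<2 * Suc k}}"
      then have s: "\<sigma> permutes ?S" and n: "\<not> \<sigma> permutes {2..<2 * Suc k}" by auto
      have "F \<sigma> = 0" if "\<sigma> 0 = 0"
      proof -
        have "\<sigma> 1 \<noteq> 1"
        proof
          assume "\<sigma> 1 = 1"
          have "\<sigma> permutes {2..<2 * Suc k}"
          proof (rule permutes_superset[OF s])
            fix x assume "x \<in> ?S - {2..<2 * Suc k}"
            then have "x = 0 \<or> x = 1" by auto
            then show "\<sigma> x = x" using that \<open>\<sigma> 1 = 1\<close> by auto
          qed
          with n show False by simp
        qed
        moreover have "\<sigma> 1 \<noteq> 0" using that permutes_inj[OF s] by (metis inj_eq zero_neq_one)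
        moreover have "\<sigma> 1 < 2 * Suc k" using permutes_in_image[OF s, of 1] by simp
        ultimately have "\<omega> [f (\<sigma> 0), f (\<sigma> 1)] = 0" using orth[of "\<sigma> 1"] that by simp
        then show ?thesis unfolding F_def prod.lessThan_Suc_shift by simp
      qed
      then show "(if \<sigma> 0 = 0 then F \<sigma> else 0) = 0" by simp
    qed
  next
    fix \<sigma> :: "nat \<Rightarrow> nat" assume "\<sigma> \<in> {\<sigma>. \<sigma> permutes {2..<2 * Suc k}}"
    then show "(if \<sigma> 0 = 0 then F \<sigma> else 0) = F \<sigma>" using permutes_not_in[of \<sigma> _ 0] by auto
  next
    show "{\<sigma>. \<sigma> permutes {2..<2 * Suc k}} \<subseteq> {\<sigma>. \<sigma> permutes ?S}"
      by (auto elim: permutes_subset)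
  qed (simp add: finite_permutations)
  also have "\<dots> = (\<Sum>\<tau> | \<tau> permutes {..<2 * k}. \<omega> [f 0, f 1] * (of_int (sign \<tau>) *
      (\<Prod>i<k. \<omega> [f (\<tau> (2 * i) + 2), f (\<tau> (2 * i + 1) + 2)])))"
  proof -
    let ?h = "\<lambda>i::nat. i + 2"
    have bij: "bij_betw ?h {..<2 * k} {2..<2 * Suc k}"
      using image_add_atLeastLessThan'[of 2 0 "2 * k"]
      by (auto simp: bij_betw_def inj_on_def lessThan_atLeast0 ac_simps numeral_2_eq_2)
    have "F (map_permutation {..<2 * k} ?h \<tau>) = \<omega> [f 0, f 1] * (of_int (sign \<tau>) *
      (\<Prod>i<k. \<omega> [f (\<tau> (2 * i) + 2), f (\<tau> (2 * i + 1) + 2)]))" if t: "\<tau> permutes {..<2 * k}" for \<tau>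
    proof -
      note sh = shift_permutation[OF t]
      show ?thesis
        unfolding F_def prod.lessThan_Suc_shift
        using sh(3) sh(4)[of "2 * _"] sh(4)[of "2 * _ + 1"] sh(5,6) by (auto intro!: prod.cong)
    qed
    moreover have "bij_betw (map_permutation {..<2 * k} ?h) {\<tau>. \<tau> permutes {..<2 * k}} {\<sigma>. \<sigma> permutes {2..<2 * Suc k}}"
    proof -
      have "map_permutation {..<2 * k} ?h = (\<lambda>\<pi> x. if x \<in> {2..<2 * Suc k} then \<pi> (inv_into {..<2 * k} ?h x) + 2 else x)"
        unfolding map_permutation_def restrict_id_def bij_betw_imp_surj_on[OF bij] o_def by (rule refl)
      then show ?thesis using bij_betw_permutations[OF bij] by (simp only:)
    qed
    ultimately show ?thesis
      by (subst sum.reindex_bij_betw[symmetric]) (auto intro!: sum.cong)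
  qed
  also have "\<dots> = \<omega> [f 0, f 1] * pairing_sum \<omega> k (\<lambda>i. f (i + 2))"
    by (simp add: pairing_sum_def sum_distrib_left)
  finally show ?thesis by (simp add: mult.assoc)
qed

section \<open>Hermitian metrics\<close>

locale hermitian =
  fixes J :: "'a::euclidean_space \<Rightarrow> 'a" and g :: "'a \<Rightarrow> 'a \<Rightarrow> real"
  assumes linear_J: "linear J" and J_J [simp]: "J (J x) = - x" and metric: "compatible_metric J g"
begin

lemma bilinear_g: "bilinear g" and g_commute: "g x y = g y x" and g_pos: "x \<noteq> 0 \<Longrightarrow> g x x > 0"
  and g_J [simp]: "g (J x) (J y) = g x y"
  using metric by (auto simp: compatible_metric_def)

lemmas J_linear [simp] = linear_add[OF linear_J] linear_diff[OF linear_J] linear_neg[OF linear_J]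
  linear_scale[OF linear_J] linear_0[OF linear_J] linear_sum[OF linear_J]

lemmas g_bilinear [simp] = bilinear_ladd[OF bilinear_g] bilinear_radd[OF bilinear_g]
  bilinear_lmul[OF bilinear_g] bilinear_rmul[OF bilinear_g] bilinear_lneg[OF bilinear_g]
  bilinear_rneg[OF bilinear_g] bilinear_lzero[OF bilinear_g] bilinear_rzero[OF bilinear_g]
  bilinear_lsub[OF bilinear_g] bilinear_rsub[OF bilinear_g]

lemma linear_g_left: "linear (\<lambda>x. g x y)" and linear_g_right: "linear (g x)"
  using bilinear_g by (auto simp: bilinear_def)

lemma g_sum_left: "g (\<Sum>i\<in>A. f i) y = (\<Sum>i\<in>A. g (f i) y)"
  using linear_sum[OF linear_g_left] .

lemma g_sum_right: "g x (\<Sum>i\<in>A. f i) = (\<Sum>i\<in>A. g x (f i))"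
  using linear_sum[OF linear_g_right] .

lemma g_nonneg: "g x x \<ge> 0" and g_eq_0_iff [simp]: "g x x = 0 \<longleftrightarrow> x = 0"
  using g_pos[of x] by (cases "x = 0"; force)+

lemma g_J_left: "g (J x) y = - g x (J y)"
  using g_J[of x "J y"] by simp

lemma g_J_self [simp]: "g (J x) x = 0" "g x (J x) = 0"
  using g_J_left[of x x] g_commute[of x "J x"] by auto

text \<open>For \<open>J\<close>-invariant \<open>S\<close> this is an orthonormal basis over the
  complex numbers: \<open>E\<close> and its image under \<open>J\<close> form a real orthonormal
  basis. Spanning is expressed by the expansion formula, the form in which traces need it.\<close>

definition unitary_basis :: "'a set \<Rightarrow> 'a set \<Rightarrow> bool"
  where "unitary_basis S E \<longleftrightarrow> finite E \<and> E \<subseteq> S \<and>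
    (\<forall>e\<in>E. \<forall>f\<in>E. g e f = (if e = f then 1 else 0) \<and> g (J e) f = 0) \<and>
    (\<forall>x\<in>S. x = (\<Sum>e\<in>E. g x e *\<^sub>R e + g x (J e) *\<^sub>R J e))"

text \<open>One Gram-Schmidt step: subtracting the components along \<open>e\<close> and
  \<open>J e\<close> moves a vector of \<open>S\<close> into the complement. It serves the induction
  below and later completes bases through prescribed vectors.\<close>

lemma unitary_basis_extend:
  assumes E': "unitary_basis {y\<in>S. g y e = 0 \<and> g y (J e) = 0} E'"
    and e: "e \<in> S" "g e e = 1" and S: "subspace S" "\<And>x. x \<in> S \<Longrightarrow> J x \<in> S"
  shows "unitary_basis S (insert e E')"
proof -
  let ?S' = "{y\<in>S. g y e = 0 \<and> g y (J e) = 0}"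
  have fin: "finite E'" and sub: "E' \<subseteq> ?S'"
    and on: "\<And>a b. a \<in> E' \<Longrightarrow> b \<in> E' \<Longrightarrow> g a b = (if a = b then 1 else 0) \<and> g (J a) b = 0"
    and ex: "\<And>x. x \<in> ?S' \<Longrightarrow> x = (\<Sum>e\<in>E'. g x e *\<^sub>R e + g x (J e) *\<^sub>R J e)"
    using E' by (auto simp: unitary_basis_def)
  have perp: "g a e = 0" "g a (J e) = 0" "g e a = 0" "g (J e) a = 0" "g e (J a) = 0" "g (J a) e = 0"
    if "a \<in> E'" for a
    using that sub g_commute[of a e] g_commute[of a "J e"] g_J_left[of e a] g_J_left[of a e] by auto
  have ne: "e \<notin> E'" using perp(1) e(2) by fastforce
  have "x = (\<Sum>a\<in>insert e E'. g x a *\<^sub>R a + g x (J a) *\<^sub>R J a)" if x: "x \<in> S" for x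
  proof -
    let ?x' = "x - g x e *\<^sub>R e - g x (J e) *\<^sub>R J e"
    have "?x' \<in> S" using S x e by (auto intro!: subspace_diff subspace_scale)
    then have "?x' \<in> ?S'" using e by (simp add: g_J_left)
    from ex[OF this] have "?x' = (\<Sum>a\<in>E'. g x a *\<^sub>R a + g x (J a) *\<^sub>R J a)"
      by (simp add: perp)
    then show ?thesis using fin ne by (simp add: algebra_simps)
  qed
  moreover have "insert e E' \<subseteq> S" using sub e by auto
  ultimately show ?thesis
    unfolding unitary_basis_def using fin on perp e ne by auto
qed

lemma ex_unitary_basis:
  assumes "subspace S" "\<And>x. x \<in> S \<Longrightarrow> J x \<in> S"
  shows "\<exists>E. unitary_basis S E"
  using assms
proof (induction "dim S" arbitrary: S rule: less_induct)
  case less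
  show ?case
  proof (cases "S \<subseteq> {0}")
    case True
    then show ?thesis by (auto simp: unitary_basis_def intro!: exI[of _ "{}"])
  next
    case False
    then obtain x where x: "x \<in> S" "x \<noteq> 0" by auto
    define e where "e = x /\<^sub>R sqrt (g x x)"
    have e: "e \<in> S" "g e e = 1"
      using x less.prems(1) g_pos[of x] by (auto simp: e_def subspace_scale field_simps)
    let ?S' = "{y\<in>S. g y e = 0 \<and> g y (J e) = 0}"
    have S': "subspace ?S'" using less.prems(1) by (auto simp: subspace_def)
    have "dim ?S' < dim S"
    proof -
      have "e \<notin> ?S'" using e by auto
      then have "?S' \<noteq> S" using e(1) by metis
      then have "dim ?S' \<noteq> dim S" using subspace_dim_equal[OF S' less.prems(1)] by auto
      moreover have "dim ?S' \<le> dim S" by (rule dim_subset) auto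
      ultimately show ?thesis by simp
    qed
    moreover have "J y \<in> ?S'" if "y \<in> ?S'" for y
      using that less.prems(2) by (auto simp: g_J_left)
    ultimately obtain E' where "unitary_basis ?S' E'" using less.hyps[OF _ S'] by blast
    from unitary_basis_extend[OF this e less.prems] show ?thesis by blast
  qed
qed

text \<open>Insert the expansion of each standard basis vector and exchange the sums; the standard
  inner product then recombines to \<open>f e\<close> and \<open>f (J e)\<close> and
  disappears.\<close>

lemma endo_trace_unitary_basis:
  assumes E: "unitary_basis UNIV E" and f: "linear f"
  shows "endo_trace f = (\<Sum>e\<in>E. g (f e) e + g (f (J e)) (J e))"
proof -
  have ex: "x = (\<Sum>e\<in>E. g x e *\<^sub>R e + g x (J e) *\<^sub>R J e)" for x
    using E by (auto simp: unitary_basis_def)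
  have "endo_trace f = (\<Sum>b\<in>Basis. f (\<Sum>e\<in>E. g b e *\<^sub>R e + g b (J e) *\<^sub>R J e) \<bullet> b)"
    unfolding endo_trace_def using ex by simp
  also have "\<dots> = (\<Sum>b\<in>Basis. \<Sum>e\<in>E. g ((f e \<bullet> b) *\<^sub>R b) e + g ((f (J e) \<bullet> b) *\<^sub>R b) (J e))"
    by (simp add: linear_sum[OF f] linear_add[OF f] linear_scale[OF f] inner_sum_left inner_add_left ac_simps)
  also have "\<dots> = (\<Sum>e\<in>E. \<Sum>b\<in>Basis. g ((f e \<bullet> b) *\<^sub>R b) e + g ((f (J e) \<bullet> b) *\<^sub>R b) (J e))"
    by (rule sum.swap)
  also have "\<dots> = (\<Sum>e\<in>E. g (\<Sum>b\<in>Basis. (f e \<bullet> b) *\<^sub>R b) e + g (\<Sum>b\<in>Basis. (f (J e) \<bullet> b) *\<^sub>R b) (J e))"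
    by (simp only: sum.distrib g_sum_left)
  finally show ?thesis by (simp only: euclidean_representation)
qed

text \<open>Both sides are the trace of the identity.\<close>

lemma card_unitary_basis:
  assumes "unitary_basis (UNIV :: 'a set) E"
  shows "2 * card E = DIM('a)"
proof -
  have "endo_trace (\<lambda>x::'a. x) = (\<Sum>e\<in>E. g e e + g (J e) (J e))"
    by (rule endo_trace_unitary_basis[OF assms]) (rule linear_id[unfolded id_def])
  also have "\<dots> = (\<Sum>e\<in>E. 2)" using assms by (intro sum.cong) (auto simp: unitary_basis_def)
  finally have "real (2 * card E) = real DIM('a)" by (simp add: endo_trace_def)
  then show ?thesis by linarith
qed

end

section \<open>Balanced metrics on unimodular Lie algebras\<close>

lemma pairing_sum_compose:
  assumes "\<tau> permutes {..<2 * k}"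
  shows "pairing_sum \<omega> k (\<lambda>i. f (\<tau> i)) = of_int (sign \<tau>) * pairing_sum \<omega> k f"
proof -
  have "of_int (sign \<tau>) * pairing_sum \<omega> k f = (\<Sum>\<sigma> | \<sigma> permutes {..<2 * k}. of_int (sign \<tau>) * (of_int (sign (\<tau> \<circ> \<sigma>)) *
      (\<Prod>i<k. \<omega> [f ((\<tau> \<circ> \<sigma>) (2 * i)), f ((\<tau> \<circ> \<sigma>) (2 * i + 1))])))"
    unfolding pairing_sum_def sum_distrib_left
    by (rule setum_permutations_compose_left[OF assms])
  also have "\<dots> = pairing_sum \<omega> k (\<lambda>i. f (\<tau> i))"
    unfolding pairing_sum_def
  proof (rule sum.cong[OF refl], goal_cases)
    case (1 \<sigma>)
    then have "sign (\<tau> \<circ> \<sigma>) = sign \<tau> * sign \<sigma>"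
      using assms by (intro sign_compose) (auto intro: permutation_permutes[THEN iffD2])
    then show ?case by (simp flip: of_int_mult mult.assoc)
  qed
  finally show ?thesis ..
qed

text \<open>Every permutation puts \<open>p\<close> into some pair, and the factor of this pair is
  zero.\<close>

lemma pairing_sum_eq_0:
  assumes skew: "\<And>x y. \<omega> [x, y] = - \<omega> [y, x]" and p: "p < 2 * k"
    and orth: "\<And>j. j < 2 * k \<Longrightarrow> \<omega> [f p, f j] = 0"
  shows "pairing_sum \<omega> k f = 0"
  unfolding pairing_sum_def
proof (rule sum.neutral, rule ballI)
  fix \<sigma> :: "nat \<Rightarrow> nat" assume "\<sigma> \<in> {\<sigma>. \<sigma> permutes {..<2 * k}}"
  then have s: "\<sigma> permutes {..<2 * k}" by simp
  define q where "q = inv \<sigma> p"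
  have q: "\<sigma> q = p" using permutes_inverses[OF s] by (simp add: q_def)
  have "q < 2 * k" using permutes_in_image[OF permutes_inv[OF s], of p] p by (simp add: q_def)
  then have i: "q div 2 < k" by auto
  have lt: "\<sigma> (2 * (q div 2)) < 2 * k" "\<sigma> (2 * (q div 2) + 1) < 2 * k"
    using i permutes_in_image[OF s, of "2 * (q div 2)"] permutes_in_image[OF s, of "2 * (q div 2) + 1"] by auto
  have "\<omega> [f (\<sigma> (2 * (q div 2))), f (\<sigma> (2 * (q div 2) + 1))] = 0"
    using orth[OF lt(1)] orth[OF lt(2)] q skew[of "f (\<sigma> (2 * (q div 2)))" "f p"]
    by (cases "even q") (auto elim!: evenE oddE)
  with i have "(\<Prod>i<k. \<omega> [f (\<sigma> (2 * i)), f (\<sigma> (2 * i + 1))]) = 0"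
    by (intro prod_zero) auto
  then show "of_int (sign \<sigma>) * (\<Prod>i<k. \<omega> [f (\<sigma> (2 * i)), f (\<sigma> (2 * i + 1))]) = 0" by simp
qed

section \<open>Evaluating powers of a two-form\<close>

locale two_form =
  fixes \<omega> :: "'a form"
  assumes deg: "\<And>xs. length xs \<noteq> 2 \<Longrightarrow> \<omega> xs = 0"
    and skew: "\<And>x y. \<omega> [x, y] = - \<omega> [y, x]"
begin

lemma wedge_power_eq_0:
  assumes z: "z \<in> set xs" "\<And>y. y \<in> set xs \<Longrightarrow> \<omega> [z, y] = 0"
  shows "wedge_power \<omega> k xs = 0"
proof (cases "length xs = 2 * k")
  case True
  obtain p where p: "p < length xs" "xs ! p = z" using z(1) by (auto simp: in_set_conv_nth)
  have "pairing_sum \<omega> k ((!) xs) = 0"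
    by (rule pairing_sum_eq_0[where \<omega> = \<omega> and p = p, OF skew]) (use p z True in auto)
  then show ?thesis by (simp add: wedge_power_pairing_sum[OF deg])
qed (simp add: wedge_power_pairing_sum[OF deg])

lemma wedge_power_swap:
  "wedge_power \<omega> k (us @ a # b # vs) = - wedge_power \<omega> k (us @ b # a # vs)"
proof -
  let ?n = "length us" and ?xs = "us @ b # a # vs"
  let ?t = "Transposition.transpose ?n (Suc ?n)"
  have eq: "(us @ a # b # vs) ! i = ?xs ! ?t i" for i
  proof -
    consider "i < ?n" | "i = ?n" | "i = Suc ?n" | "i > Suc ?n" by linarith
    then show ?thesis by cases (auto simp: nth_append Transposition.transpose_def nth_Cons')
  qed
  have "pairing_sum \<omega> k ((!) (us @ a # b # vs)) = - pairing_sum \<omega> k ((!) ?xs)" if "2 * k = length ?xs"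
  proof -
    have "?t permutes {..<2 * k}" using that by (intro permutes_swap_id) auto
    from pairing_sum_compose[OF this, of \<omega> "(!) ?xs"] show ?thesis
      unfolding eq[symmetric] by (simp add: sign_swap_id)
  qed
  then show ?thesis by (auto simp: wedge_power_pairing_sum[OF deg])
qed

lemma wedge_power_move:
  "wedge_power \<omega> k (us @ ps @ z # vs) = (- 1) ^ length ps * wedge_power \<omega> k (us @ z # ps @ vs)"
proof (induction ps arbitrary: us)
  case (Cons p ps)
  from Cons.IH[of "us @ [p]"] show ?case using wedge_power_swap[of k us p z "ps @ vs"] by simp
qed simp

text \<open>Contracting \<open>z\<close> into the power \<open>Suc k\<close> of
  \<open>\<omega>\<close> gives \<open>Suc k\<close> times the wedge of the contracted
  \<open>\<omega>\<close> with the power \<open>k\<close>. Only \<open>y\<close> can be paired with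
  \<open>z\<close>, so one term is left.\<close>

lemma wedge_power_contract:
  assumes "\<And>x. x \<in> set rest \<Longrightarrow> \<omega> [z, x] = 0"
  shows "wedge_power \<omega> (Suc k) (z # y # rest) = of_nat (Suc k) * \<omega> [z, y] * wedge_power \<omega> k rest"
proof (cases "length rest = 2 * k")
  case True
  have "pairing_sum \<omega> (Suc k) ((!) (z # y # rest)) = of_nat (2 * Suc k) * \<omega> [z, y] * pairing_sum \<omega> k ((!) rest)"
    using assms True
    by (subst pairing_sum_contract[where \<omega> = \<omega>, OF skew]) (auto simp: nth_Cons')
  then show ?thesis using True
    by (simp add: wedge_power_pairing_sum[OF deg] field_simps del: wedge_power.simps)
qed (simp add: wedge_power_pairing_sum[OF deg] del: wedge_power.simps)

end

lemma nths_delete: "nths (us @ a # vs) (- {length us}) = us @ vs"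
  by (auto simp: nths_append nths_Cons nths_all)

lemma nths_delete2: "nths (us @ a # b # vs) (- {length us, Suc (length us)}) = us @ vs"
  by (auto simp: nths_append nths_Cons nths_all)

text \<open>Pairs of indices that contain the first argument are separated from the others. The
  others keep their sign, both indices being shifted by one; in the former only one index is
  shifted, whence the minus.\<close>

lemma ce_d_Cons:
  "ce_d br \<alpha> (x # xs) =
    (\<Sum>j<length xs. \<Sum>i<j. (-1) ^ (i + j) * \<alpha> (br (xs ! i) (xs ! j) # x # nths xs (- {i, j}))) -
    (\<Sum>j<length xs. (-1) ^ j * \<alpha> (br x (xs ! j) # nths xs (- {j})))"
proof -
  have n: "nths (x # xs) (- {0, Suc j}) = nths xs (- {j})"
    "nths (x # xs) (- {Suc i, Suc j}) = x # nths xs (- {i, j})" for i j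
    by (auto simp: nths_Cons intro!: arg_cong[where f = "nths xs"])
  show ?thesis
    unfolding ce_d_def list.size add.right_neutral add_Suc_right sum.lessThan_Suc_shift
    by (simp add: n sum.distrib sum_negf sum_subtractf)
qed

lemma sum_lessThan_double:
  fixes h :: "nat \<Rightarrow> 'b::comm_monoid_add"
  shows "(\<Sum>j<2 * m. h j) = (\<Sum>k<m. h (2 * k) + h (2 * k + 1))"
  by (induction m) (simp_all add: ac_simps)

section \<open>The balanced condition in a unitary basis\<close>

context hermitian
begin

abbreviation "\<omega> \<equiv> kaehler_form J g"

lemma kaehler_form_pair [simp]: "\<omega> [x, y] = complex_of_real (g (J x) y)"
  by (simp add: kaehler_form_def)

lemma kaehler_form_deg: "length xs \<noteq> 2 \<Longrightarrow> \<omega> xs = 0"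
  by (auto simp: kaehler_form_def split: list.splits)

lemma kaehler_form_skew: "\<omega> [x, y] = - \<omega> [y, x]"
  using g_J_left[of x y] g_commute[of x "J y"] by simp

sublocale form: two_form \<omega>
  by unfold_locales (fact kaehler_form_deg, fact kaehler_form_skew)

definition pairs :: "'a list \<Rightarrow> 'a list"
  where "pairs es = concat (map (\<lambda>e. [e, J e]) es)"

lemma pairs_simps [simp]: "pairs [] = []" "pairs (e # es) = e # J e # pairs es"
  "pairs (us @ vs) = pairs us @ pairs vs" "length (pairs es) = 2 * length es"
  "set (pairs es) = set es \<union> J ` set es"
  by (auto simp: pairs_def length_concat sum_list_triv comp_def)

lemma nth_pairs:
  assumes "k < length es"
  shows "pairs es ! (2 * k) = es ! k" "pairs es ! (2 * k + 1) = J (es ! k)"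
proof -
  have "pairs es = pairs (take k es) @ es ! k # J (es ! k) # pairs (drop (Suc k) es)"
    using id_take_nth_drop[OF assms] by (metis pairs_simps(2,3))
  moreover have "length (pairs (take k es)) = 2 * k" using assms by simp
  ultimately show "pairs es ! (2 * k) = es ! k" "pairs es ! (2 * k + 1) = J (es ! k)"
    by (metis nth_append_length, simp add: nth_append)
qed

definition orthonormal_list :: "'a list \<Rightarrow> bool"
  where "orthonormal_list es \<longleftrightarrow> distinct es \<and>
    (\<forall>e\<in>set es. \<forall>f\<in>set es. g e f = (if e = f then 1 else 0) \<and> g (J e) f = 0)"

text \<open>Contract \<open>e\<close> with \<open>J e\<close>, on which \<open>\<omega>\<close> is
  \<open>1\<close>, and go on with the remaining pairs.\<close>

lemma wedge_power_pairs:
  "orthonormal_list es \<Longrightarrow> wedge_power \<omega> (length es) (pairs es) = fact (length es)"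
proof (induction es)
  case (Cons e es)
  then have o: "orthonormal_list es" by (auto simp: orthonormal_list_def)
  have "wedge_power \<omega> (Suc (length es)) (e # J e # pairs es) =
      of_nat (Suc (length es)) * \<omega> [e, J e] * wedge_power \<omega> (length es) (pairs es)"
    by (rule form.wedge_power_contract) (use Cons.prems in \<open>auto simp: orthonormal_list_def\<close>)
  also have "\<omega> [e, J e] = 1" using Cons.prems by (auto simp: orthonormal_list_def)
  finally show ?case using Cons.IH[OF o] by (simp del: wedge_power.simps)
qed (simp add: unit_form_def)

text \<open>The partner of \<open>z\<close> is missing and \<open>y\<close> stands in front as its
  replacement. Moving \<open>z\<close> past the even number of vectors in \<open>pairs us\<close>
  costs no sign, moving it past \<open>y\<close> gives the minus; then \<open>z\<close> can be
  contracted with \<open>y\<close> only.\<close>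

lemma wedge_power_gap:
  assumes o: "orthonormal_list (us @ vs)"
    and z: "\<And>x. x \<in> set us \<union> set vs \<Longrightarrow> g (J z) x = 0 \<and> g z x = 0"
  shows "wedge_power \<omega> (Suc (length (us @ vs))) (y # pairs us @ z # pairs vs) =
    - (fact (Suc (length (us @ vs))) * complex_of_real (g (J z) y))"
proof -
  let ?m = "Suc (length (us @ vs))"
  have "wedge_power \<omega> ?m (y # pairs us @ z # pairs vs) = wedge_power \<omega> ?m (y # z # pairs us @ pairs vs)"
    using form.wedge_power_move[of ?m "[y]" "pairs us" z "pairs vs"] by (simp del: wedge_power.simps)
  also have "\<dots> = - wedge_power \<omega> ?m (z # y # pairs us @ pairs vs)"
    using form.wedge_power_swap[of ?m "[]" y z "pairs us @ pairs vs"] by (simp del: wedge_power.simps)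
  also have "wedge_power \<omega> ?m (z # y # pairs us @ pairs vs) =
      of_nat ?m * \<omega> [z, y] * wedge_power \<omega> (length (us @ vs)) (pairs us @ pairs vs)"
    by (rule form.wedge_power_contract) (use z in auto)
  also have "wedge_power \<omega> (length (us @ vs)) (pairs us @ pairs vs) = fact (length (us @ vs))"
    using wedge_power_pairs[OF o] by (simp del: length_append)
  finally show ?thesis by simp
qed

text \<open>When the deleted entries do not form a pair, the partner of entry \<open>i\<close> is
  left over, and \<open>\<omega>\<close> pairs it to zero with everything that remains.\<close>

lemma wedge_power_nths_pairs_eq_0:
  assumes o: "orthonormal_list es" and ij: "i < j" "j < 2 * length es" and ne: "\<not> (even i \<and> j = Suc i)"
  shows "wedge_power \<omega> k (nths (pairs es) (- {i, j})) = 0"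
proof -
  \<comment> \<open>The position of the partner of entry \<open>i\<close>.\<close>
  define p where "p = (if even i then Suc i else i - 1)"
  have p: "p < 2 * length es" "p \<noteq> i" "p \<noteq> j"
    using ij ne by (auto simp: p_def elim: oddE)
  have orth: "\<omega> [pairs es ! p, pairs es ! l] = 0" if l: "l < 2 * length es" "l \<noteq> i" for l
  proof -
    have d: "p div 2 < length es" "l div 2 < length es" using p l by auto
    have eq: "es ! (p div 2) = es ! (l div 2) \<longleftrightarrow> p div 2 = l div 2"
      using o d by (simp add: orthonormal_list_def nth_eq_iff_index_eq)
    have on: "g (es ! (p div 2)) (es ! (l div 2)) = (if p div 2 = l div 2 then 1 else 0)"
      "g (J (es ! (p div 2))) (es ! (l div 2)) = 0"
      "g (es ! (p div 2)) (J (es ! (l div 2))) = 0"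
      using o d eq g_J_left[of "es ! (p div 2)" "es ! (l div 2)"] by (auto simp: orthonormal_list_def)
    note np = nth_pairs[OF d(1)] and nl = nth_pairs[OF d(2)]
    have im: "p div 2 = l div 2 \<Longrightarrow> even p = even l"
      using l(2) unfolding p_def by (cases "even i"; simp) presburger+
    show ?thesis
      using np nl on im by (cases "even p"; cases "even l") (auto elim!: evenE oddE)
  qed
  have "pairs es ! p \<in> set (nths (pairs es) (- {i, j}))"
    using p by (auto simp: set_nths simp del: pairs_simps(5))
  moreover have "\<omega> [pairs es ! p, y] = 0" if y: "y \<in> set (nths (pairs es) (- {i, j}))" for y
  proof -
    from y obtain l where "l < 2 * length es" "l \<noteq> i" "y = pairs es ! l"
      unfolding set_nths pairs_simps by blast
    then show ?thesis using orth by blast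
  qed
  ultimately show ?thesis by (rule form.wedge_power_eq_0)
qed

text \<open>The differential of the power of \<open>\<omega>\<close> is evaluated on
  \<open>e0\<close> followed by the pairs \<open>e, J e\<close> of the other basis vectors. Brackets
  with \<open>e0\<close> add up to a trace of \<open>br e0\<close> that lacks \<open>e0\<close>,
  brackets inside a pair give \<open>g (br e (J e)) (J e0)\<close>, and all others contribute
  nothing. Unimodularity turns the incomplete trace into minus the missing summand of
  \<open>e0\<close>.\<close>

lemma balanced_unitary_basis:
  assumes br: "bilinear br" "\<And>x. br x x = 0" and uni: "unimodular br" and bal: "balanced br J g"
    and E: "unitary_basis UNIV E" and e0: "e0 \<in> E"
  shows "g (\<Sum>e\<in>E. br e (J e)) (J e0) = 0"
proof -
  have fin: "finite E" and on: "\<And>a b. a \<in> E \<Longrightarrow> b \<in> E \<Longrightarrow> g a b = (if a = b then 1 else 0) \<and> g (J a) b = 0"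
    using E by (auto simp: unitary_basis_def)
  have on': "a \<in> E \<Longrightarrow> b \<in> E \<Longrightarrow> g a (J b) = 0" for a b
    using on[of b a] g_commute[of a "J b"] by simp
  obtain es where es: "set es = E - {e0}" "distinct es"
    using finite_distinct_list[of "E - {e0}"] fin by auto
  let ?m = "length es"
  have card: "card E = Suc ?m"
    using es fin e0 distinct_card[OF es(2)] by (metis card_Suc_Diff1)
  have o: "orthonormal_list es" using es on by (auto simp: orthonormal_list_def)
  define \<alpha> where "\<alpha> = wedge_power \<omega> ?m"
  have d: "ce_d br \<alpha> (e0 # pairs es) = 0"
  proof -
    have "DIM('a) div 2 - 1 = ?m" using card_unitary_basis[OF E] card by linarith
    then show ?thesis using bal by (simp add: balanced_def \<alpha>_def)
  qed
  have sum_es: "(\<Sum>k<?m. f (es ! k)) = (\<Sum>e\<in>E - {e0}. f e)" for f :: "'a \<Rightarrow> complex"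
    using sum.reindex_bij_betw[OF bij_betw_nth[OF es(2) refl es(1)[symmetric]], of f] by simp
  have split: "\<exists>us vs. es = us @ es ! k # vs \<and> length us = k \<and> ?m = Suc (length (us @ vs)) \<and> orthonormal_list (us @ vs) \<and>
      set us \<union> set vs \<subseteq> E - {e0, es ! k} \<and> es ! k \<in> E" if k: "k < ?m" for k
  proof (intro exI conjI)
    let ?us = "take k es" and ?vs = "drop (Suc k) es"
    show eq: "es = ?us @ es ! k # ?vs" using id_take_nth_drop[OF k] .
    show "length ?us = k" "?m = Suc (length (?us @ ?vs))" using k by auto
    show "es ! k \<in> E" using es(1) k nth_mem by blast
    have dist: "distinct (?us @ es ! k # ?vs)" using es(2) eq by metis
    have set_eq: "set es = insert (es ! k) (set ?us \<union> set ?vs)" by (subst eq) simp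
    then show "set ?us \<union> set ?vs \<subseteq> E - {e0, es ! k}" using es(1) dist by auto
    show "orthonormal_list (?us @ ?vs)"
      using o set_eq dist by (auto simp: orthonormal_list_def)
  qed
  \<comment> \<open>In \<open>A\<close> and \<open>B\<close> the vector replaced by its bracket with
    \<open>e0\<close> leaves its partner alone; in \<open>C\<close> a whole pair is removed and
    \<open>e0\<close> itself is the vector without partner.\<close>
  have A: "\<alpha> (br e0 (es ! k) # nths (pairs es) (- {2 * k})) = fact ?m * complex_of_real (g (br e0 (es ! k)) (es ! k))"
   and B: "\<alpha> (br e0 (J (es ! k)) # nths (pairs es) (- {2 * k + 1})) = - (fact ?m * complex_of_real (g (br e0 (J (es ! k))) (J (es ! k))))"
   and C: "\<alpha> (br (es ! k) (J (es ! k)) # e0 # nths (pairs es) (- {2 * k, 2 * k + 1})) = - (fact ?m * complex_of_real (g (br (es ! k) (J (es ! k))) (J e0)))"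
    if k: "k < ?m" for k
  proof -
    define e where "e = es ! k"
    from split[OF k] obtain us vs where uv: "es = us @ e # vs" "length us = k" "?m = Suc (length (us @ vs))" "orthonormal_list (us @ vs)"
      "set us \<union> set vs \<subseteq> E - {e0, e}" "e \<in> E" unfolding e_def by blast
    have perp: "g e x = 0 \<and> g (J e) x = 0 \<and> g e0 x = 0 \<and> g (J e0) x = 0" if "x \<in> set us \<union> set vs" for x
    proof -
      have "x \<in> E" "x \<noteq> e" "x \<noteq> e0" using uv(5) that by auto
      then show ?thesis using on e0 uv(6) by auto
    qed
    have n: "nths (pairs es) (- {2 * k}) = pairs us @ J e # pairs vs"
      "nths (pairs es) (- {2 * k + 1}) = pairs us @ e # pairs vs"
      "nths (pairs es) (- {2 * k, 2 * k + 1}) = pairs us @ pairs vs"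
      using uv(2) nths_delete[of "pairs us" e "J e # pairs vs"] nths_delete[of "pairs us @ [e]" "J e" "pairs vs"]
        nths_delete2[of "pairs us" e "J e" "pairs vs"] by (auto simp: uv(1))
    show "\<alpha> (br e0 (es ! k) # nths (pairs es) (- {2 * k})) = fact ?m * complex_of_real (g (br e0 (es ! k)) (es ! k))"
      unfolding n \<alpha>_def e_def[symmetric] uv(3)
      by (subst wedge_power_gap[OF uv(4)]) (use perp in \<open>auto simp: g_commute[of "br e0 e" e]\<close>)
    show "\<alpha> (br e0 (J (es ! k)) # nths (pairs es) (- {2 * k + 1})) = - (fact ?m * complex_of_real (g (br e0 (J (es ! k))) (J (es ! k))))"
      unfolding n \<alpha>_def e_def[symmetric] uv(3)
      by (subst wedge_power_gap[OF uv(4)]) (use perp in \<open>auto simp: g_commute[of "br e0 (J e)" "J e"]\<close>)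
    show "\<alpha> (br (es ! k) (J (es ! k)) # e0 # nths (pairs es) (- {2 * k, 2 * k + 1})) = - (fact ?m * complex_of_real (g (br (es ! k) (J (es ! k))) (J e0)))"
      unfolding n \<alpha>_def e_def[symmetric] uv(3)
      using wedge_power_gap[of "[]" "us @ vs" e0 "br e (J e)"] uv(4) perp
      by (auto simp: g_commute[of "br e (J e)" "J e0"] simp del: wedge_power.simps)
  qed
  \<comment> \<open>Here \<open>e0\<close> can only be paired with the bracket, and the remaining
    list contains an entry without its partner.\<close>
  have D: "\<alpha> (br (pairs es ! i) (pairs es ! j) # e0 # nths (pairs es) (- {i, j})) = 0"
    if ij: "i < j" "j < 2 * ?m" "\<not> (even i \<and> j = Suc i)" for i j
  proof -
    let ?y = "br (pairs es ! i) (pairs es ! j)"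
    obtain m' where m': "?m = Suc m'" using ij by (cases ?m) auto
    have "\<omega> [e0, x] = 0" if "x \<in> set (nths (pairs es) (- {i, j}))" for x
    proof -
      have "x \<in> set (pairs es)" using that set_nths_subset by fast
      then obtain e where "e \<in> E" "e \<noteq> e0" "x = e \<or> x = J e" using es by auto
      then show ?thesis using on e0 by auto
    qed
    then have "wedge_power \<omega> (Suc m') (e0 # ?y # nths (pairs es) (- {i, j})) =
        of_nat (Suc m') * \<omega> [e0, ?y] * wedge_power \<omega> m' (nths (pairs es) (- {i, j}))"
      by (rule form.wedge_power_contract)
    then show ?thesis
      using wedge_power_nths_pairs_eq_0[OF o ij] form.wedge_power_swap[of ?m "[]" ?y e0 "nths (pairs es) (- {i, j})"]
      unfolding \<alpha>_def m' by (simp del: wedge_power.simps)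
  qed
  have S1: "(\<Sum>j<2 * ?m. \<Sum>i<j. (-1) ^ (i + j) * \<alpha> (br (pairs es ! i) (pairs es ! j) # e0 # nths (pairs es) (- {i, j})))
    = (\<Sum>k<?m. fact ?m * complex_of_real (g (br (es ! k) (J (es ! k))) (J e0)))"
  proof (subst sum_lessThan_double, rule sum.cong[OF refl], goal_cases)
    case (1 k)
    then have k: "k < ?m" by simp
    have a: "(\<Sum>i<2 * k. (-1) ^ (i + 2 * k) * \<alpha> (br (pairs es ! i) (pairs es ! (2 * k)) # e0 # nths (pairs es) (- {i, 2 * k}))) = 0"
    proof (intro sum.neutral ballI)
      fix i assume "i \<in> {..<2 * k}"
      moreover have "\<not> (even i \<and> 2 * k = Suc i)" by presburger
      ultimately show "(-1) ^ (i + 2 * k) * \<alpha> (br (pairs es ! i) (pairs es ! (2 * k)) # e0 # nths (pairs es) (- {i, 2 * k})) = 0"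
        using D[of i "2 * k"] k by simp
    qed
    have b: "(\<Sum>i<2 * k + 1. (-1) ^ (i + (2 * k + 1)) * \<alpha> (br (pairs es ! i) (pairs es ! (2 * k + 1)) # e0 # nths (pairs es) (- {i, 2 * k + 1})))
       = (\<Sum>i\<in>{2 * k}. (-1) ^ (i + (2 * k + 1)) * \<alpha> (br (pairs es ! i) (pairs es ! (2 * k + 1)) # e0 # nths (pairs es) (- {i, 2 * k + 1})))"
    proof (rule sum.mono_neutral_right)
      show "\<forall>i\<in>{..<2 * k + 1} - {2 * k}. (-1) ^ (i + (2 * k + 1)) * \<alpha> (br (pairs es ! i) (pairs es ! (2 * k + 1)) # e0 # nths (pairs es) (- {i, 2 * k + 1})) = 0"
      proof
        fix i assume "i \<in> {..<2 * k + 1} - {2 * k}"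
        then show "(-1) ^ (i + (2 * k + 1)) * \<alpha> (br (pairs es ! i) (pairs es ! (2 * k + 1)) # e0 # nths (pairs es) (- {i, 2 * k + 1})) = 0"
          using D[of i "2 * k + 1"] k by simp
      qed
    qed auto
    show ?case unfolding a b using C[OF k] nth_pairs[OF k] by simp
  qed
  have S2: "(\<Sum>j<2 * ?m. (-1) ^ j * \<alpha> (br e0 (pairs es ! j) # nths (pairs es) (- {j})))
    = (\<Sum>k<?m. fact ?m * complex_of_real (g (br e0 (es ! k)) (es ! k) + g (br e0 (J (es ! k))) (J (es ! k))))"
    unfolding sum_lessThan_double
    by (rule sum.cong[OF refl]) (use A B nth_pairs in \<open>simp add: algebra_simps\<close>)
  let ?t = "\<lambda>e. g (br e0 e) e + g (br e0 (J e)) (J e)"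
  have "0 = fact ?m * complex_of_real ((\<Sum>e\<in>E - {e0}. g (br e (J e)) (J e0)) - (\<Sum>e\<in>E - {e0}. ?t e))"
    using d unfolding ce_d_Cons pairs_simps S1 S2
    unfolding sum_es[of "\<lambda>e. fact ?m * complex_of_real (?t e)"] sum_es[of "\<lambda>e. fact ?m * complex_of_real (g (br e (J e)) (J e0))"]
    by (simp add: sum_distrib_left algebra_simps)
  then have "(\<Sum>e\<in>E - {e0}. g (br e (J e)) (J e0)) = (\<Sum>e\<in>E - {e0}. ?t e)"
    by (simp del: of_real_sum of_real_diff)
  moreover have "linear (br e0)" using br(1) by (simp add: bilinear_def)
  then have "(\<Sum>e\<in>E. ?t e) = 0"
    using endo_trace_unitary_basis[OF E, of "br e0"] uni by (simp add: unimodular_def)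
  \<comment> \<open>The trace over all of \<open>E\<close> vanishes, so the part without
    \<open>e0\<close> is minus \<open>?t e0\<close>, which reduces to
    \<open>g (br e0 (J e0)) (J e0)\<close>.\<close>
  then have "(\<Sum>e\<in>E - {e0}. ?t e) = - ?t e0" using fin e0 by (simp add: sum.remove)
  ultimately show ?thesis using fin e0 br(2) by (simp add: g_sum_left sum.remove)
qed

text \<open>The preceding lemma kills the components along the vectors \<open>J e0\<close>.
  Replacing \<open>e0\<close> by \<open>J e0\<close> in the basis leaves the sum unchanged, because
  \<open>br (J e0) (J (J e0)) = br e0 (J e0)\<close>, and the same lemma then kills the components
  along \<open>e0\<close>.\<close>

lemma balanced_imp_sum_eq_0:
  assumes br: "bilinear br" "\<And>x. br x x = 0" and uni: "unimodular br" and bal: "balanced br J g"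
    and E: "unitary_basis UNIV E"
  shows "(\<Sum>e\<in>E. br e (J e)) = 0"
proof -
  let ?s = "\<Sum>e\<in>E. br e (J e)"
  have fin: "finite E" and on: "\<And>a b. a \<in> E \<Longrightarrow> b \<in> E \<Longrightarrow> g a b = (if a = b then 1 else 0) \<and> g (J a) b = 0"
    and ex: "\<And>x. x = (\<Sum>e\<in>E. g x e *\<^sub>R e + g x (J e) *\<^sub>R J e)"
    using E by (auto simp: unitary_basis_def)
  have anti: "br x y = - br y x" for x y
  proof -
    have "br x y + br y x = br (x + y) (x + y) - br x x - br y y"
      by (simp add: bilinear_ladd[OF br(1)] bilinear_radd[OF br(1)])
    then show ?thesis by (simp add: br(2) eq_neg_iff_add_eq_0)
  qed
  have "g ?s e0 = 0" if e0: "e0 \<in> E" for e0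
  proof -
    let ?E = "insert (J e0) (E - {e0})"
    have on': "a \<in> E \<Longrightarrow> b \<in> E \<Longrightarrow> g a (J b) = 0" for a b
      using on[of b a] g_commute[of a "J b"] by simp
    have ne: "J e0 \<notin> E" using on[OF e0, of "J e0"] e0 on[OF e0 e0] by auto
    have "unitary_basis UNIV ?E"
      unfolding unitary_basis_def
    proof (intro conjI ballI)
      show "finite ?E" "?E \<subseteq> UNIV" using fin by auto
      fix e f assume "e \<in> ?E" "f \<in> ?E"
      then show "g e f = (if e = f then 1 else 0)" "g (J e) f = 0"
        using on on' e0 ne by auto
    next
      fix x
      have "x = g x e0 *\<^sub>R e0 + g x (J e0) *\<^sub>R J e0 + (\<Sum>e\<in>E - {e0}. g x e *\<^sub>R e + g x (J e) *\<^sub>R J e)"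
        using ex[of x] sum.remove[OF fin e0, of "\<lambda>e. g x e *\<^sub>R e + g x (J e) *\<^sub>R J e"] by simp
      also have "\<dots> = (\<Sum>e\<in>?E. g x e *\<^sub>R e + g x (J e) *\<^sub>R J e)"
        using fin ne by simp
      finally show "x = (\<Sum>e\<in>?E. g x e *\<^sub>R e + g x (J e) *\<^sub>R J e)" .
    qed
    from balanced_unitary_basis[OF br uni bal this, of "J e0"]
    have "g (\<Sum>e\<in>?E. br e (J e)) e0 = 0" by simp
    moreover have "(\<Sum>e\<in>?E. br e (J e)) = ?s"
      using fin e0 ne anti[of "J e0" e0] by (simp add: sum.remove bilinear_rneg[OF br(1)])
    ultimately show ?thesis by simp
  qed
  then have "?s = (\<Sum>e\<in>E. 0)"
    using ex[of ?s] balanced_unitary_basis[OF br uni bal E] by simp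
  then show ?thesis by simp
qed

end

section \<open>Bidegrees and the pluriclosed equation\<close>

lemma sum_Pow_insert:
  fixes F :: "'a set \<Rightarrow> 'b::comm_monoid_add"
  assumes "finite A" "a \<notin> A"
  shows "(\<Sum>S\<in>Pow (insert a A). F S) = (\<Sum>S\<in>Pow A. F S) + (\<Sum>S\<in>Pow A. F (insert a S))"
proof -
  have "(\<Sum>S\<in>Pow (insert a A). F S) = (\<Sum>S\<in>Pow A. F S) + (\<Sum>S\<in>insert a ` Pow A. F S)"
    unfolding Pow_insert using assms by (intro sum.union_disjoint) auto
  also have "(\<Sum>S\<in>insert a ` Pow A. F S) = (\<Sum>S\<in>Pow A. F (insert a S))"
    using assms by (subst sum.reindex) (auto simp: inj_on_def)
  finally show ?thesis .
qed

text \<open>Moving the cardinality condition into the summand lets \<open>sum_Pow_insert\<close>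
  expand the sum in \<open>bidegree_part\<close> one element at a time.\<close>

lemma sum_subsets_card:
  fixes F :: "'a set \<Rightarrow> 'b::comm_monoid_add"
  assumes "finite A"
  shows "(\<Sum>S | S \<subseteq> A \<and> card S = p. F S) = (\<Sum>S\<in>Pow A. if card S = p then F S else 0)"
proof -
  have "{S. S \<subseteq> A \<and> card S = p} = {S \<in> Pow A. card S = p}" by auto
  then show ?thesis using sum.inter_filter[of "Pow A" F "\<lambda>S. card S = p"] assms by (simp only: finite_Pow_iff)
qed

lemma cext_cong:
  "(\<And>ys. length ys = length zs \<Longrightarrow> \<alpha> ys = \<beta> ys) \<Longrightarrow> cext \<alpha> zs = cext \<beta> zs"
proof (induction zs arbitrary: \<alpha> \<beta>)
  case (Cons z zs)
  have "cext (\<lambda>ys. \<alpha> (v # ys)) zs = cext (\<lambda>ys. \<beta> (v # ys)) zs" for v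
    by (rule Cons.IH) (simp add: Cons.prems)
  then show ?case by simp
qed simp

lemma cext_0 [simp]: "cext (\<lambda>_. 0) zs = 0"
  by (induction zs) auto

lemma bidegree_part_eq_0:
  assumes "\<And>ys. length ys = p + q \<Longrightarrow> \<alpha> ys = 0"
  shows "bidegree_part J p q \<alpha> = (\<lambda>_. 0)"
proof
  fix xs
  have "cext \<alpha> zs = 0" if "length zs = p + q" for zs
    using cext_cong[of zs \<alpha> "\<lambda>_. 0"] that assms by simp
  then show "bidegree_part J p q \<alpha> xs = 0" by (simp add: bidegree_part_def)
qed

lemma bidegree_part_length: "length xs \<noteq> p + q \<Longrightarrow> bidegree_part J p q \<alpha> xs = 0"
  by (simp add: bidegree_part_def)

lemma bidegree_part_2:
  "bidegree_part J 2 0 \<alpha> [x, y] = cext \<alpha> [part10 J x, part10 J y]"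
  "bidegree_part J 1 1 \<alpha> [x, y] = cext \<alpha> [part10 J x, part01 J y] + cext \<alpha> [part01 J x, part10 J y]"
  "bidegree_part J 0 2 \<alpha> [x, y] = cext \<alpha> [part01 J x, part01 J y]"
  by (simp_all add: bidegree_part_def sum_subsets_card lessThan_Suc sum_Pow_insert del: cext.simps)

lemma bidegree_part_3:
  "bidegree_part J 3 0 \<alpha> [x, y, z] = cext \<alpha> [part10 J x, part10 J y, part10 J z]"
  "bidegree_part J 2 1 \<alpha> [x, y, z] = cext \<alpha> [part10 J x, part10 J y, part01 J z] +
    cext \<alpha> [part10 J x, part01 J y, part10 J z] + cext \<alpha> [part01 J x, part10 J y, part10 J z]"
  "bidegree_part J 1 2 \<alpha> [x, y, z] = cext \<alpha> [part10 J x, part01 J y, part01 J z] +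
    cext \<alpha> [part01 J x, part10 J y, part01 J z] + cext \<alpha> [part01 J x, part01 J y, part10 J z]"
  "bidegree_part J 0 3 \<alpha> [x, y, z] = cext \<alpha> [part01 J x, part01 J y, part01 J z]"
  by (simp_all add: bidegree_part_def sum_subsets_card lessThan_Suc sum_Pow_insert del: cext.simps)

lemma bidegree_part_2_2:
  "bidegree_part J 2 2 \<alpha> [x, y, z, w] =
    cext \<alpha> [part10 J x, part10 J y, part01 J z, part01 J w] + cext \<alpha> [part10 J x, part01 J y, part10 J z, part01 J w] +
    cext \<alpha> [part10 J x, part01 J y, part01 J z, part10 J w] + cext \<alpha> [part01 J x, part10 J y, part10 J z, part01 J w] +
    cext \<alpha> [part01 J x, part10 J y, part01 J z, part10 J w] + cext \<alpha> [part01 J x, part01 J y, part10 J z, part10 J w]"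
  by (simp_all add: bidegree_part_def sum_subsets_card lessThan_Suc sum_Pow_insert del: cext.simps)

lemma ce_d_3: "ce_d br \<alpha> [x, y, z] = - \<alpha> [br x y, z] + \<alpha> [br x z, y] - \<alpha> [br y z, x]"
  by (simp add: ce_d_def lessThan_Suc nths_Cons)

lemma ce_d_4: "ce_d br \<alpha> [x, y, z, w] = - \<alpha> [br x y, z, w] + \<alpha> [br x z, y, w] - \<alpha> [br x w, y, z]
    - \<alpha> [br y z, x, w] + \<alpha> [br y w, x, z] - \<alpha> [br z w, x, y]"
  by (simp add: ce_d_def lessThan_Suc nths_Cons)

lemma ce_d_0 [simp]: "ce_d br (\<lambda>_. 0) = (\<lambda>_. 0)"
  by (auto simp: ce_d_def)

text \<open>If \<open>z\<close> and \<open>z'\<close> are the \<open>(1, 0)\<close> and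
  \<open>(0, 1)\<close> components of \<open>x\<close>, then \<open>J x = \<i> z - \<i> z'\<close>,
  so the bivector of \<open>x\<close> and \<open>J x\<close> is a multiple of that of
  \<open>z\<close> and \<open>z'\<close> and has bidegree \<open>(1, 1)\<close>. The same holds for
  \<open>y\<close>, so only the component of bidegree \<open>(2, 2)\<close> sees these
  arguments.\<close>

lemma bidegree_part_2_2_diagonal:
  fixes b :: "'a::real_vector form"
  assumes J: "\<And>x. J (J x) = - x"
    and lin: "\<And>x z w. linear (\<lambda>y. b [x, y, z, w])" "\<And>x y w. linear (\<lambda>z. b [x, y, z, w])"
    and alt: "\<And>x y z w. b [x, y, z, w] = - b [y, x, z, w]" "\<And>x y z w. b [x, y, z, w] = - b [x, y, w, z]"
  shows "bidegree_part J 2 2 b [x, J x, y, J y] = b [x, J x, y, J y]"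
proof -
  have lin1: "linear (\<lambda>x. b [x, y, z, w])" for y z w
    unfolding alt(1)[of _ y] by (rule linear_compose_neg[OF lin(1)])
  have lin4: "linear (\<lambda>w. b [x, y, z, w])" for x y z
    unfolding alt(2)[of _ _ z] by (rule linear_compose_neg[OF lin(2)])
  note rules = linear_scale[OF lin1] linear_scale[OF lin(1)] linear_scale[OF lin(2)] linear_scale[OF lin4]
    linear_neg[OF lin1] linear_neg[OF lin(1)] linear_neg[OF lin(2)] linear_neg[OF lin4]
  have eq0: "b [u, u, z, w] = 0" "b [z, w, u, u] = 0" for u z w
    using alt(1)[of u u z w] alt(2)[of z w u u] by auto
  show ?thesis
    unfolding bidegree_part_2_2
    by (simp add: part10_def part01_def rules J eq0 alt(1)[of "J x" x] alt(2)[of _ _ "J y" y] scaleR_conv_of_real field_simps)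
qed


lemma (in lie_algebra) bracket_anticommute: "br x y = - br y x"
proof -
  have "br x y + br y x = br (x + y) (x + y) - br x x - br y y"
    by (simp add: bilinear_ladd[OF bilinear_bracket] bilinear_radd[OF bilinear_bracket])
  then show ?thesis by (simp add: bracket_self eq_neg_iff_add_eq_0)
qed

lemmas (in lie_algebra) bracket_bilinear [simp] =
  bilinear_ladd[OF bilinear_bracket] bilinear_radd[OF bilinear_bracket]
  bilinear_lmul[OF bilinear_bracket] bilinear_rmul[OF bilinear_bracket]
  bilinear_lneg[OF bilinear_bracket] bilinear_rneg[OF bilinear_bracket]
  bilinear_lzero[OF bilinear_bracket] bilinear_rzero[OF bilinear_bracket]
  bilinear_lsub[OF bilinear_bracket] bilinear_rsub[OF bilinear_bracket]

locale complex_lie_algebra = lie_algebra br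
  for br :: "'a::euclidean_space \<Rightarrow> 'a \<Rightarrow> 'a" +
  fixes J :: "'a \<Rightarrow> 'a"
  assumes integrable: "complex_structure br J"
begin

lemma J_props: "linear J" "J (J x) = - x"
  using integrable by (auto simp: complex_structure_def)

lemma nijenhuis: "br (J x) (J y) = br x y + J (br (J x) y) + J (br x (J y))"
proof -
  have "br x y - br (J x) (J y) + J (br (J x) y) + J (br x (J y)) = 0"
    using integrable by (simp add: complex_structure_def)
  then show ?thesis by (metis (no_types, lifting) add.assoc diff_add_eq eq_iff_diff_eq_0)
qed

end

locale hermitian_lie = hermitian J g + complex_lie_algebra br J
  for J :: "'a::euclidean_space \<Rightarrow> 'a" and g and br
begin

text \<open>The values of the differential of \<open>\<omega>\<close> as real numbers, so that the
  computations can stay in the reals.\<close>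

definition dw :: "'a \<Rightarrow> 'a \<Rightarrow> 'a \<Rightarrow> real"
  where "dw x y z = - g (J (br x y)) z + g (J (br x z)) y - g (J (br y z)) x"

text \<open>Real form of the fact that the differential of \<open>\<omega>\<close> has no components
  of bidegree \<open>(3, 0)\<close> and \<open>(0, 3)\<close>: on these the right-hand side would be
  \<open>-3\<close> times the left-hand side. It follows by rewriting the brackets of two
  \<open>J\<close>-images with \<open>nijenhuis\<close>.\<close>

lemma dw_type: "dw x y z = dw x (J y) (J z) + dw (J x) y (J z) + dw (J x) (J y) z"
  unfolding dw_def nijenhuis[of x y] nijenhuis[of x z] nijenhuis[of y z] by simp

lemma dw_alt: "dw y x z = - dw x y z" "dw x z y = - dw x y z"
  using bracket_anticommute[of y x] bracket_anticommute[of z y] by (simp_all add: dw_def)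

lemma dw_linear [simp]:
  "dw (x + x') y z = dw x y z + dw x' y z" "dw x (y + y') z = dw x y z + dw x y' z"
  "dw x y (z + z') = dw x y z + dw x y z'"
  "dw (r *\<^sub>R x) y z = r * dw x y z" "dw x (r *\<^sub>R y) z = r * dw x y z" "dw x y (r *\<^sub>R z) = r * dw x y z"
  "dw (- x) y z = - dw x y z" "dw x (- y) z = - dw x y z" "dw x y (- z) = - dw x y z"
  by (simp_all add: dw_def algebra_simps)

lemma ce_d_kaehler_form_3 [simp]: "ce_d br \<omega> [x, y, z] = complex_of_real (dw x y z)"
  by (simp add: ce_d_3 dw_def)

text \<open>The metric is \<open>J\<close>-invariant, so \<open>\<omega>\<close> vanishes on two
  vectors of the same type.\<close>

lemma bidegree_part_kaehler_form:
  "bidegree_part J p q \<omega> = (if p = 1 \<and> q = 1 then \<omega> else (\<lambda>_. 0))"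
proof (cases "p + q = 2")
  case True
  then consider "p = 2" "q = 0" | "p = 1" "q = 1" | "p = 0" "q = 2" by linarith
  then show ?thesis
  proof cases
    case 1
    have "bidegree_part J 2 0 \<omega> xs = 0" for xs
    proof (cases "length xs = 2")
      case True
      then obtain x y where "xs = [x, y]" by (auto simp: length_Suc_conv numeral_2_eq_2)
      then show ?thesis by (simp add: bidegree_part_2[unfolded One_nat_def] part10_def complex_eq_iff g_J_left)
    qed (simp add: bidegree_part_length)
    then show ?thesis using 1 by auto
  next
    case 2
    have "bidegree_part J 1 1 \<omega> xs = \<omega> xs" for xs
    proof (cases "length xs = 2")
      case True
      then obtain x y where "xs = [x, y]" by (auto simp: length_Suc_conv numeral_2_eq_2)
      then show ?thesis by (simp add: bidegree_part_2[unfolded One_nat_def] part10_def part01_def complex_eq_iff g_J_left)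
    qed (simp add: bidegree_part_length kaehler_form_deg)
    then show ?thesis using 2 by auto
  next
    case 3
    have "bidegree_part J 0 2 \<omega> xs = 0" for xs
    proof (cases "length xs = 2")
      case True
      then obtain x y where "xs = [x, y]" by (auto simp: length_Suc_conv numeral_2_eq_2)
      then show ?thesis by (simp add: bidegree_part_2[unfolded One_nat_def] part01_def complex_eq_iff g_J_left)
    qed (simp add: bidegree_part_length)
    then show ?thesis using 3 by auto
  qed
next
  case False
  then show ?thesis by (auto intro!: bidegree_part_eq_0 kaehler_form_deg)
qed

text \<open>This is \<open>delbar\<close> of \<open>\<omega>\<close>. Inserting \<open>J\<close> in
  all three arguments multiplies the \<open>(2, 1)\<close> part of the differential of
  \<open>\<omega>\<close> by \<open>\<i>\<close> and the \<open>(1, 2)\<close> part by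
  \<open>- \<i>\<close>, so half the sum of the differential and \<open>\<i>\<close> times its
  \<open>J\<close>-twist is the \<open>(1, 2)\<close> part.\<close>

definition \<eta> :: "'a form"
  where "\<eta> xs = (case xs of [x, y, z] \<Rightarrow> Complex (dw x y z / 2) (dw (J x) (J y) (J z) / 2) | _ \<Rightarrow> 0)"

lemma \<eta>_3 [simp]: "\<eta> [x, y, z] = Complex (dw x y z / 2) (dw (J x) (J y) (J z) / 2)"
  by (simp add: \<eta>_def)

lemma \<eta>_deg: "length xs \<noteq> 3 \<Longrightarrow> \<eta> xs = 0"
  by (auto simp: \<eta>_def split: list.splits)

lemma bidegree_part_0 [simp]: "bidegree_part J p q (\<lambda>_. 0) = (\<lambda>_. 0)"
  by (rule bidegree_part_eq_0) simp

lemma list_3_cases: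
  assumes "length xs = 3" obtains x y z where "xs = [x, y, z]"
  using assms by (auto simp: length_Suc_conv numeral_3_eq_3)

lemma bidegree_part_1_2_dw: "bidegree_part J 1 2 (ce_d br \<omega>) = \<eta>"
proof
  fix xs
  show "bidegree_part J 1 2 (ce_d br \<omega>) xs = \<eta> xs"
  proof (cases "length xs = 3")
    case True
    then obtain x y z where "xs = [x, y, z]" by (rule list_3_cases)
    then show ?thesis
      using dw_type[of x y z] dw_type[of "J x" "J y" "J z"]
      by (simp add: bidegree_part_3[unfolded One_nat_def] part10_def part01_def complex_eq_iff field_simps)
  qed (simp add: bidegree_part_length \<eta>_deg)
qed

lemma delbar_kaehler_form: "delbar br J \<omega> = \<eta>"
proof
  fix xs
  have t: "bidegree_part J p (Suc q) (ce_d br (bidegree_part J p q \<omega>)) xs = (if p = 1 then if q = 1 then \<eta> xs else 0 else 0)" for p q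
    unfolding bidegree_part_kaehler_form using bidegree_part_1_2_dw by (auto simp: numeral_2_eq_2)
  show "delbar br J \<omega> xs = \<eta> xs"
  proof (cases "length xs = 3")
    case True
    then show ?thesis unfolding delbar_def t by (simp add: eval_nat_numeral)
  next
    case False
    then show ?thesis unfolding delbar_def t \<eta>_deg[OF False] by (auto intro!: sum.neutral)
  qed
qed

lemma bidegree_part_\<eta>: "bidegree_part J p q \<eta> = (if p = 1 \<and> q = 2 then \<eta> else (\<lambda>_. 0))"
proof (cases "p + q = 3")
  case True
  have "bidegree_part J p q \<eta> xs = (if p = 1 \<and> q = 2 then \<eta> xs else 0)" for xs
  proof (cases "length xs = 3")
    case l: True
    then obtain x y z where xs: "xs = [x, y, z]" by (rule list_3_cases)
    from True consider "p = 3" "q = 0" | "p = 2" "q = 1" | "p = 1" "q = 2" | "p = 0" "q = 3" by linarith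
    then show ?thesis
      using dw_type[of x y z] dw_type[of "J x" "J y" "J z"] xs
      by cases (simp_all add: bidegree_part_3[unfolded One_nat_def] part10_def part01_def complex_eq_iff field_simps)
  qed (simp add: bidegree_part_length \<eta>_deg True)
  then show ?thesis by auto
next
  case False
  then show ?thesis by (auto intro!: bidegree_part_eq_0 \<eta>_deg)
qed

lemma del_\<eta>_4: "length xs = 4 \<Longrightarrow> del br J \<eta> xs = bidegree_part J 2 2 (ce_d br \<eta>) xs"
proof -
  assume l: "length xs = 4"
  have t: "bidegree_part J (Suc p) q (ce_d br (bidegree_part J p q \<eta>)) xs =
     (if p = 1 then if q = 2 then bidegree_part J 2 2 (ce_d br \<eta>) xs else 0 else 0)" for p q
    unfolding bidegree_part_\<eta> by (auto simp: numeral_2_eq_2)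
  show ?thesis unfolding del_def t by (simp add: l eval_nat_numeral)
qed

text \<open>The condition obtained from evaluating the pluriclosed equation on \<open>(x, Jx, y, Jy)\<close>, where a
  \<open>4\<close>-form and its component of bidegree \<open>(2, 2)\<close> take the same value.\<close>

lemma pluriclosed_eq:
  assumes "pluriclosed br J g"
  defines "c \<equiv> \<lambda>x y z. dw (J x) (J y) (J z)"
  shows "- c (br x (J x)) y (J y) + c (br x y) (J x) (J y) - c (br x (J y)) (J x) y
    - c (br (J x) y) x (J y) + c (br (J x) (J y)) x y - c (br y (J y)) x (J x) = 0"
proof -
  have lin: "linear (\<lambda>y. ce_d br \<eta> [x, y, z, w])" "linear (\<lambda>z. ce_d br \<eta> [x, y, z, w])" for x y z w
    by (auto intro!: linearI simp: ce_d_4 complex_eq_iff field_simps)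
  have alt: "ce_d br \<eta> [x, y, z, w] = - ce_d br \<eta> [y, x, z, w]" "ce_d br \<eta> [x, y, z, w] = - ce_d br \<eta> [x, y, w, z]" for x y z w
    using bracket_anticommute[of y x] bracket_anticommute[of w z]
      dw_alt(2)[of "br z w" y x] dw_alt(2)[of "J (br z w)" "J y" "J x"]
      dw_alt(2)[of "br x y" w z] dw_alt(2)[of "J (br x y)" "J w" "J z"]
    by (simp_all add: ce_d_4 complex_eq_iff)
  have "bidegree_part J 2 2 (ce_d br \<eta>) [x, J x, y, J y] = ce_d br \<eta> [x, J x, y, J y]"
    by (rule bidegree_part_2_2_diagonal[OF J_J lin alt])
  moreover have "bidegree_part J 2 2 (ce_d br \<eta>) [x, J x, y, J y] = 0"
    using assms(1) del_\<eta>_4[of "[x, J x, y, J y]"] by (simp add: pluriclosed_def delbar_kaehler_form)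
  \<comment> \<open>The imaginary part of the equation is half the differential of \<open>c\<close>
    on these four vectors.\<close>
  ultimately show ?thesis by (simp add: ce_d_4 complex_eq_iff c_def)
qed

end

section \<open>Bases and projections for \<open>J\<close>-invariant subspaces\<close>

context hermitian
begin

lemma unitary_basis_orthonormal:
  assumes E: "unitary_basis S E" and S: "J ` S \<subseteq> S"
  defines "B \<equiv> E \<union> J ` E"
  shows "finite B" "B \<subseteq> S" "\<And>a b. a \<in> B \<Longrightarrow> b \<in> B \<Longrightarrow> g a b = (if a = b then 1 else 0)"
    and "\<And>x. x \<in> S \<Longrightarrow> x = (\<Sum>b\<in>B. g x b *\<^sub>R b)" and "card B = 2 * card E"
proof -
  have fin: "finite E" and on: "\<And>a b. a \<in> E \<Longrightarrow> b \<in> E \<Longrightarrow> g a b = (if a = b then 1 else 0) \<and> g (J a) b = 0"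
    and ES: "E \<subseteq> S" and ex: "\<And>x. x \<in> S \<Longrightarrow> x = (\<Sum>e\<in>E. g x e *\<^sub>R e + g x (J e) *\<^sub>R J e)"
    using E by (auto simp: unitary_basis_def)
  have on': "a \<in> E \<Longrightarrow> b \<in> E \<Longrightarrow> g a (J b) = 0" for a b
    using on[of b a] g_commute[of a "J b"] by simp
  have inj: "inj_on J E" by (metis J_J inj_onI neg_equal_iff_equal)
  have disj: "E \<inter> J ` E = {}" using on on' by force
  show "finite B" "B \<subseteq> S" using fin ES S by (auto simp: B_def)
  show "g a b = (if a = b then 1 else 0)" if "a \<in> B" "b \<in> B" for a b
    using that on on' disj inj by (auto simp: B_def inj_on_eq_iff)
  show "card B = 2 * card E"
    using disj fin by (simp add: B_def card_Un_disjoint card_image[OF inj])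
  show "x = (\<Sum>b\<in>B. g x b *\<^sub>R b)" if "x \<in> S" for x
    using ex[OF that] disj fin
    by (simp add: B_def sum.union_disjoint sum.reindex[OF inj] sum.distrib)
qed

text \<open>The real orthonormal basis made from a unitary one has twice as many elements.\<close>

lemma dim_J_invariant:
  assumes S: "subspace S" "\<And>x. x \<in> S \<Longrightarrow> J x \<in> S"
  shows "even (dim S)"
proof -
  obtain E where E: "unitary_basis S E" using ex_unitary_basis[OF S] by blast
  have "J ` S \<subseteq> S" using S(2) by blast
  note B = unitary_basis_orthonormal[OF E this]
  let ?B = "E \<union> J ` E"
  have "independent ?B"
  proof (rule independent_if_scalars_zero)
    show "finite ?B" by (rule B(1))
    fix f x assume f: "(\<Sum>b\<in>?B. f b *\<^sub>R b) = 0" and x: "x \<in> ?B"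
    have "0 = (\<Sum>b\<in>?B. f b * g b x)"
      using arg_cong[OF f, of "\<lambda>z. g z x"] by (simp add: g_sum_left)
    also have "\<dots> = (\<Sum>b\<in>?B. if b = x then f b else 0)"
      using B(3) x by (intro sum.cong) auto
    finally show "f x = 0" using B(1) x by simp
  qed
  moreover have "S \<subseteq> span ?B"
  proof
    fix x assume x: "x \<in> S"
    have "(\<Sum>b\<in>?B. g x b *\<^sub>R b) \<in> span ?B" by (intro span_sum span_scale span_base)
    then show "x \<in> span ?B" using B(4)[OF x] by simp
  qed
  ultimately have "card ?B = dim S" using B(2) by (metis basis_card_eq_dim)
  then show ?thesis using B(5) by (metis dvd_triv_left)
qed

lemma ex_orthogonal_projection:
  assumes S: "subspace S" "\<And>x. x \<in> S \<Longrightarrow> J x \<in> S"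
  obtains p where "p \<in> S" "\<And>s. s \<in> S \<Longrightarrow> g (x - p) s = 0"
proof -
  obtain E where E: "unitary_basis S E" using ex_unitary_basis[OF S] by blast
  have "J ` S \<subseteq> S" using S(2) by blast
  note B = unitary_basis_orthonormal[OF E this]
  let ?B = "E \<union> J ` E" and ?p = "\<Sum>b\<in>E \<union> J ` E. g x b *\<^sub>R b"
  have b: "g (x - ?p) b = 0" if "b \<in> ?B" for b
  proof -
    have "g ?p b = (\<Sum>c\<in>?B. if c = b then g x c else 0)"
      unfolding g_sum_left using B(3) that by (intro sum.cong) auto
    then show ?thesis using B(1) that by simp
  qed
  show thesis
  proof
    show "?p \<in> S" using S(1) B(2) by (auto intro!: subspace_sum subspace_scale)
    fix s assume "s \<in> S"
    then have "g (x - ?p) s = g (x - ?p) (\<Sum>b\<in>?B. g s b *\<^sub>R b)" using B(4) by simp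
    also have "\<dots> = 0" unfolding g_sum_right using b by (intro sum.neutral) auto
    finally show "g (x - ?p) s = 0" .
  qed
qed

end

section \<open>Abelian ideals of codimension two\<close>

locale abelian_ideal = complex_lie_algebra br J
  for br :: "'a::euclidean_space \<Rightarrow> 'a \<Rightarrow> 'a" and J :: "'a \<Rightarrow> 'a" +
  fixes A :: "'a set"
  assumes ideal: "lie_ideal br A" and abelian: "abelian_on br A"
begin

text \<open>The intersection of \<open>A\<close> with its image under \<open>J\<close>, the largest
  \<open>J\<close>-invariant subspace of \<open>A\<close>.\<close>

definition W :: "'a set" where "W = {w \<in> A. J w \<in> A}"

lemma subspace_A: "subspace A" using ideal by (simp add: lie_ideal_def)

lemma bracket_in_A: "y \<in> A \<Longrightarrow> br x y \<in> A" "y \<in> A \<Longrightarrow> br y x \<in> A"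
  using ideal bracket_anticommute[of y x] subspace_neg[OF subspace_A, of "br x y"] by (auto simp: lie_ideal_def)

lemma bracket_A [simp]: "x \<in> A \<Longrightarrow> y \<in> A \<Longrightarrow> br x y = 0"
  using abelian by (simp add: abelian_on_def)

lemma W_sub_A: "w \<in> W \<Longrightarrow> w \<in> A" by (simp add: W_def)

lemma J_W: "w \<in> W \<Longrightarrow> J w \<in> W"
  using subspace_neg[OF subspace_A, of w] by (simp add: W_def J_props)

lemma subspace_W: "subspace W"
  using subspace_A unfolding W_def subspace_def
  by (auto simp: linear_add[OF J_props(1)] linear_scale[OF J_props(1)] linear_0[OF J_props(1)])

text \<open>In \<open>nijenhuis\<close> the brackets \<open>br x w\<close> and
  \<open>br x (J w)\<close> vanish because \<open>A\<close> is abelian: the operator of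
  \<open>J x\<close> is complex linear on \<open>W\<close>.\<close>

lemma bracket_J_W: "x \<in> A \<Longrightarrow> w \<in> W \<Longrightarrow> br (J x) (J w) = J (br (J x) w)"
  using nijenhuis[of x w] by (simp add: W_def linear_0[OF J_props(1)])

text \<open>Complex linearity gives \<open>J (br (J x) w) = br (J x) (J w)\<close>, again an element
  of the ideal.\<close>

lemma bracket_J_in_W: "x \<in> A \<Longrightarrow> w \<in> W \<Longrightarrow> br (J x) w \<in> W"
  using bracket_J_W[of x w] bracket_in_A(1)[of w "J x"] bracket_in_A(1)[of "J w" "J x"]
  unfolding W_def by auto

lemma bracket_J_J: "x \<in> A \<Longrightarrow> y \<in> A \<Longrightarrow> br (J x) (J y) = J (br (J x) y - br (J y) x)"
  using nijenhuis[of x y] bracket_anticommute[of x "J y"]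
  by (simp add: linear_diff[OF J_props(1)] linear_neg[OF J_props(1)])

text \<open>The vectors \<open>u, v, J u, J v\<close> are a basis of the algebra modulo
  \<open>W\<close>. No metric enters, so a frame found with the balanced metric can be used with the
  pluriclosed one.\<close>

definition frame :: "'a \<Rightarrow> 'a \<Rightarrow> bool"
  where "frame u v \<longleftrightarrow> u \<in> A \<and> v \<in> A \<and>
    (\<forall>x. \<exists>w\<in>W. \<exists>a b c d. x = w + a *\<^sub>R u + b *\<^sub>R v + c *\<^sub>R J u + d *\<^sub>R J v) \<and>
    (\<forall>w\<in>W. \<forall>a b c d. w + a *\<^sub>R u + b *\<^sub>R v + c *\<^sub>R J u + d *\<^sub>R J v = 0 \<longrightarrow> a = 0 \<and> b = 0 \<and> c = 0 \<and> d = 0)"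

text \<open>A parity count of dimensions shows that \<open>A\<close> and its image under
  \<open>J\<close> span everything, so \<open>W\<close> has codimension two in \<open>A\<close>. An
  orthonormal pair \<open>u, v\<close> in \<open>A\<close>, orthogonal to \<open>W\<close>, then
  leads to a unitary basis in which the balanced condition is read off; \<open>W\<close> contributes
  nothing there, being abelian.\<close>

lemma ex_frame:
  assumes codim: "dim A + 2 = DIM('a)" and even: "even DIM('a)" and JA: "J ` A \<noteq> A"
    and h: "compatible_metric J h" and uni: "unimodular br" and bal: "balanced br J h"
  obtains u v t where "frame u v" "br (J u) u + br (J v) v + t *\<^sub>R br (J u) (J v) = 0" "t\<^sup>2 < 1"
proof -
  interpret h: hermitian J h by (intro hermitian.intro J_props h)
  have JJA: "subspace (J ` A)" using subspace_A J_props(1) linear_subspace_image by blast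
  have inj: "inj J" by (metis J_props(2) injI neg_equal_iff_equal)
  have dJA: "dim (J ` A) = dim A"
    using dim_image_eq[OF J_props(1), of A] inj by (auto intro: inj_on_subset)
  define T where "T = {x + y |x y. x \<in> A \<and> y \<in> J ` A}"
  have subT: "subspace T" unfolding T_def by (rule subspace_sums[OF subspace_A JJA])
  have AT: "A \<subseteq> T" unfolding T_def using subspace_0[OF JJA] by force
  have JAT: "J ` A \<subseteq> T" unfolding T_def using subspace_0[OF subspace_A] by force
  have W_Int: "A \<inter> J ` A = W"
    unfolding W_def using subspace_neg[OF subspace_A] J_props(2)
    by (auto simp: image_iff) (metis J_props(2) h.J_linear(3) minus_minus subspace_neg[OF subspace_A])
  have dims: "dim T + dim W = 2 * dim A"
    using dim_sums_Int[OF subspace_A JJA] dJA W_Int by (simp add: T_def)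
  have "dim A < dim T"
  proof (rule ccontr)
    assume "\<not> dim A < dim T"
    then have "A = T" using subspace_dim_equal[OF subspace_A subT AT] by simp
    then have "J ` A \<subseteq> A" using JAT by simp
    then have "J ` A = A" using subspace_dim_equal[OF JJA subspace_A] dJA by simp
    then show False using JA by simp
  qed
  \<comment> \<open>\<open>dim T\<close> is even, larger than \<open>dim A\<close> and at most
    \<open>dim A + 2\<close>, where \<open>dim A\<close> is even.\<close>
  have arith: "a < t \<Longrightarrow> even w \<Longrightarrow> t \<le> n \<Longrightarrow> t + w = 2 * a \<Longrightarrow> a + 2 = n \<Longrightarrow> even n \<Longrightarrow> t = n"
    for a t w n :: nat by presburger
  note \<open>dim A < dim T\<close>
  moreover have "even (dim W)" by (rule h.dim_J_invariant[OF subspace_W J_W])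
  moreover have "dim T \<le> DIM('a)" by (rule dim_subset_UNIV)
  ultimately have dT: "dim T = DIM('a)" 
    using dims codim even arith[of "dim A" "dim T" "dim W" "DIM('a)"] by blast
  then have dW: "dim W + 2 = dim A" using dims codim by linarith
  have T: "T = UNIV" using dT subT dim_eq_full[of T] span_eq_iff[of T] by auto
  \<comment> \<open>A Gram-Schmidt step inside \<open>A\<close>, used with \<open>u = 0\<close> for
    the first vector and then again for the second.\<close>
  have pick: "\<exists>y\<in>A. h y y = 1 \<and> (\<forall>w\<in>W. h y w = 0) \<and> h y u = 0" if u: "u \<in> A" "\<forall>w\<in>W. h u w = 0" "h u u = 1 \<or> u = 0"
    and d: "dim (insert u W) < dim A" for u
  proof -
    have "\<not> A \<subseteq> span (insert u W)" using d by (metis dim_span dim_subset not_less)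
    then obtain x where x: "x \<in> A" "x \<notin> span (insert u W)" by auto
    obtain p where p: "p \<in> W" "\<And>w. w \<in> W \<Longrightarrow> h (x - p) w = 0"
      using h.ex_orthogonal_projection[OF subspace_W J_W] by blast
    define y where "y = x - p - h x u *\<^sub>R u"
    have "y \<noteq> 0"
    proof
      assume "y = 0"
      then have "x = p + h x u *\<^sub>R u" by (simp add: y_def algebra_simps)
      also have "\<dots> \<in> span (insert u W)" using p(1) by (auto intro!: span_add span_scale intro: span_base)
      finally show False using x by simp
    qed
    then have hy: "h y y > 0" by (rule h.g_pos)
    have "y \<in> A" using x p u W_sub_A subspace_A unfolding y_def by (intro subspace_diff subspace_scale) auto
    moreover have "h y w = 0" if "w \<in> W" for w using p(2)[OF that] u that by (simp add: y_def)
    moreover have "h y u = 0" using u p(1) h.g_commute[of p u] by (auto simp: y_def)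
    ultimately show ?thesis using hy subspace_A
      by (intro bexI[of _ "y /\<^sub>R sqrt (h y y)"]) (auto simp: subspace_scale field_simps)
  qed
  have "\<exists>u\<in>A. h u u = 1 \<and> (\<forall>w\<in>W. h u w = 0) \<and> h u 0 = 0"
    by (rule pick) (use dW subspace_0[OF subspace_W] subspace_0[OF subspace_A] in \<open>auto simp: insert_absorb\<close>)
  then obtain u where u: "u \<in> A" "h u u = 1" "\<And>w. w \<in> W \<Longrightarrow> h u w = 0" by auto
  have "dim (insert u W) < dim A" using dW by (simp add: dim_insert)
  from pick[OF u(1) _ _ this] u obtain v where v: "v \<in> A" "h v v = 1" "\<And>w. w \<in> W \<Longrightarrow> h v w = 0" "h v u = 0"
    by auto
  have uv: "h u v = 0" using v h.g_commute by simp
  have spanW: "span W = W" using subspace_W span_eq_iff by blast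
  have Wu: "u \<notin> span W" unfolding spanW using u(2) u(3)[of u] by auto
  have Wuv: "v \<notin> span (insert u W)"
  proof
    assume "v \<in> span (insert u W)"
    then obtain k where "v - k *\<^sub>R u \<in> span W" by (auto simp: span_insert)
    then have "h v (v - k *\<^sub>R u) = 0" using v(3)[of "v - k *\<^sub>R u"] spanW by blast
    then show False using v(2,4) by simp
  qed
  have A: "A = span (insert v (insert u W))"
  proof (rule subspace_dim_equal[symmetric])
    show "span (insert v (insert u W)) \<subseteq> A"
      using u v W_sub_A subspace_A by (intro span_minimal) auto
    show "dim A \<le> dim (span (insert v (insert u W)))"
      unfolding dim_span using dim_insert[of v "insert u W"] dim_insert[of u W] Wu Wuv dW by simp
  qed (auto simp: subspace_A)
  have decA: "\<exists>w\<in>W. \<exists>a b. x = w + a *\<^sub>R u + b *\<^sub>R v" if "x \<in> A" for x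
  proof -
    from that A have "x \<in> span (insert v (insert u W))" by blast
    then obtain b where "x - b *\<^sub>R v \<in> span (insert u W)" unfolding span_breakdown_eq[of x v] by blast
    then obtain a where "x - b *\<^sub>R v - a *\<^sub>R u \<in> span W" unfolding span_breakdown_eq[of _ u] by blast
    then have "x - b *\<^sub>R v - a *\<^sub>R u \<in> W" using spanW by simp
    then show ?thesis by (intro bexI[of _ "x - b *\<^sub>R v - a *\<^sub>R u"] exI[of _ a] exI[of _ b]) auto
  qed
  have dec: "\<exists>w\<in>W. \<exists>a b c d. x = w + a *\<^sub>R u + b *\<^sub>R v + c *\<^sub>R J u + d *\<^sub>R J v" for x
  proof -
    have "x \<in> T" by (simp add: T)
    then obtain y z where yz: "y \<in> A" "z \<in> A" "x = y + J z" by (auto simp: T_def)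
    obtain w a b where 1: "w \<in> W" "y = w + a *\<^sub>R u + b *\<^sub>R v" using decA[OF yz(1)] by blast
    obtain w' c d where 2: "w' \<in> W" "z = w' + c *\<^sub>R u + d *\<^sub>R v" using decA[OF yz(2)] by blast
    have "w + J w' \<in> W" using 1 2 J_W subspace_W by (auto intro: subspace_add)
    moreover have "x = (w + J w') + a *\<^sub>R u + b *\<^sub>R v + c *\<^sub>R J u + d *\<^sub>R J v" by (simp add: yz 1 2)
    ultimately show ?thesis by blast
  qed
  have indA: "a = 0 \<and> b = 0" if "a *\<^sub>R u + b *\<^sub>R v \<in> W" for a b
  proof -
    have "h u (a *\<^sub>R u + b *\<^sub>R v) = 0" "h v (a *\<^sub>R u + b *\<^sub>R v) = 0" using that u(3) v(3) by blast+
    then show ?thesis using u v uv by simp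
  qed
  have ind: "a = 0 \<and> b = 0 \<and> c = 0 \<and> d = 0"
    if w: "w \<in> W" and e: "w + a *\<^sub>R u + b *\<^sub>R v + c *\<^sub>R J u + d *\<^sub>R J v = 0" for w a b c d
  proof -
    have cd: "c *\<^sub>R u + d *\<^sub>R v \<in> A" using u v subspace_A by (intro subspace_add subspace_scale) auto
    have "J (c *\<^sub>R u + d *\<^sub>R v) = - (w + a *\<^sub>R u + b *\<^sub>R v)" using e by (simp add: algebra_simps eq_neg_iff_add_eq_0)
    also have "\<dots> \<in> A" using w u v subspace_A W_sub_A by (intro subspace_neg subspace_add subspace_scale) auto
    finally have "c *\<^sub>R u + d *\<^sub>R v \<in> W" using cd by (simp add: W_def)
    from indA[OF this] have cd0: "c = 0" "d = 0" by auto
    then have "a *\<^sub>R u + b *\<^sub>R v = - w" using e by (simp add: algebra_simps eq_neg_iff_add_eq_0)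
    also have "\<dots> \<in> W" using w subspace_W by (simp add: subspace_neg)
    finally show ?thesis using indA cd0 by blast
  qed
  have frame: "frame u v" using u v dec ind unfolding frame_def by blast
  \<comment> \<open>The vectors \<open>u\<close> and \<open>v\<close> are orthonormal over the
    reals, but \<open>v\<close> need not be orthogonal to \<open>J u\<close>; \<open>t\<close>
    measures this. Independence of \<open>v\<close> and \<open>J u\<close> makes
    \<open>t\<^sup>2 < 1\<close> strict.\<close>
  define t where "t = h (J u) v"
  have ne: "h (v - t *\<^sub>R J u) (v - t *\<^sub>R J u) = 1 - t\<^sup>2"
    using u v h.g_commute[of v "J u"] by (simp add: t_def power2_eq_square algebra_simps)
  have "v - t *\<^sub>R J u \<noteq> 0" using ind[of 0 0 1 "-t" 0] subspace_0[OF subspace_W] by auto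
  then have t: "t\<^sup>2 < 1" using h.g_pos[of "v - t *\<^sub>R J u"] ne by simp
  define r where "r = sqrt (1 - t\<^sup>2)"
  have r: "r > 0" "r * r = 1 - t\<^sup>2" using t by (auto simp: r_def)
  \<comment> \<open>The normalised component of \<open>v\<close> orthogonal to \<open>u\<close> and
    \<open>J u\<close>; with \<open>u\<close> and a unitary basis of \<open>W\<close> it forms a
    unitary basis.\<close>
  define e where "e = (v - t *\<^sub>R J u) /\<^sub>R r"
  have ee: "h e e = 1"
    unfolding e_def bilinear_lmul[OF h.bilinear_g] bilinear_rmul[OF h.bilinear_g] ne
    using r by (simp add: field_simps flip: r(2))
  obtain E where E: "h.unitary_basis W E" using h.ex_unitary_basis[OF subspace_W J_W] by blast
  let ?S1 = "{y \<in> UNIV. h y u = 0 \<and> h y (J u) = 0}"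
  have vJu: "h v (J u) = t" "h u (J v) = - t" "h (J v) u = - t"
    using h.g_commute[of v "J u"] h.g_J_left[of u v] h.g_commute[of u "J v"] by (auto simp: t_def)
  have e1: "e \<in> ?S1" using u v vJu by (simp add: e_def)
  have S1: "subspace ?S1" by (auto simp: subspace_def)
  have S1J: "J x \<in> ?S1" if "x \<in> ?S1" for x using that by (simp add: h.g_J_left)
  have S2: "{y \<in> ?S1. h y e = 0 \<and> h y (J e) = 0} = W"
  proof (intro equalityI subsetI)
    fix x assume "x \<in> {y \<in> ?S1. h y e = 0 \<and> h y (J e) = 0}"
    then have x: "h x u = 0" "h x (J u) = 0" "h x e = 0" "h x (J e) = 0" by auto
    then have xv: "h x v = 0" "h x (J v) = 0" using r by (auto simp: e_def)
    obtain w a b c d where w: "w \<in> W" "x = w + a *\<^sub>R u + b *\<^sub>R v + c *\<^sub>R J u + d *\<^sub>R J v" using dec by blast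
    have wp: "h w u = 0" "h w v = 0" "h w (J u) = 0" "h w (J v) = 0"
      using u(3)[OF w(1)] v(3)[OF w(1)] u(3)[OF J_W[OF w(1)]] v(3)[OF J_W[OF w(1)]] h.g_commute[of w] h.g_J_left[of u w] h.g_J_left[of v w]
      by auto
    have "h (x - w) (a *\<^sub>R u + b *\<^sub>R v + c *\<^sub>R J u + d *\<^sub>R J v) = 0" using x xv wp by simp
    moreover have "a *\<^sub>R u + b *\<^sub>R v + c *\<^sub>R J u + d *\<^sub>R J v = x - w" using w by simp
    ultimately have "h (x - w) (x - w) = 0" by simp
    then have "x = w" unfolding h.g_eq_0_iff by simp
    then show "x \<in> W" using w(1) by simp
  next
    fix w assume w: "w \<in> W"
    then have "h w u = 0" "h w v = 0" "h w (J u) = 0" "h w (J v) = 0"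
      using u(3)[OF w] v(3)[OF w] u(3)[OF J_W[OF w]] v(3)[OF J_W[OF w]] h.g_commute[of w] h.g_J_left[of u w] h.g_J_left[of v w]
      by auto
    then show "w \<in> {y \<in> ?S1. h y e = 0 \<and> h y (J e) = 0}" by (simp add: e_def)
  qed
  have "h.unitary_basis ?S1 (insert e E)"
    by (rule h.unitary_basis_extend[OF _ e1 ee S1 S1J]) (use E S2 in auto)
  then have UB: "h.unitary_basis UNIV (insert u (insert e E))"
    by (rule h.unitary_basis_extend) (use u in auto)
  have E_W: "E \<subseteq> W" "finite E" using E by (auto simp: h.unitary_basis_def)
  have perp: "h w e = 0 \<and> h w u = 0" if "w \<in> W" for w using that unfolding S2[symmetric] by simp
  have "e \<notin> E" using perp[of e] E_W ee by auto
  moreover have "u \<notin> insert e E" using perp[of u] e1 E_W u by auto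
  moreover have "(\<Sum>w\<in>E. br w (J w)) = 0" using E_W J_W W_sub_A by (intro sum.neutral) auto
  ultimately have "br u (J u) + br e (J e) = 0"
    using h.balanced_imp_sum_eq_0[OF bilinear_bracket bracket_self uni bal UB] E_W by simp
  moreover have "br e (J e) = (1 / (1 - t\<^sup>2)) *\<^sub>R (br v (J v) - t *\<^sub>R br (J u) (J v) + (t * t) *\<^sub>R br u (J u))"
  proof -
    have "br e (J e) = (inverse r * inverse r) *\<^sub>R (br v (J v) - t *\<^sub>R br (J u) (J v) + (t * t) *\<^sub>R br u (J u))"
      using u v bracket_anticommute[of "J u" u] by (simp add: e_def algebra_simps)
    moreover have "inverse r * inverse r = 1 / (1 - t\<^sup>2)" using r by (simp add: field_simps flip: r(2))
    ultimately show ?thesis by (simp only:)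
  qed
  \<comment> \<open>The coefficient of \<open>br u (J u)\<close> is
    \<open>1 + t\<^sup>2 / (1 - t\<^sup>2) = 1 / (1 - t\<^sup>2)\<close>, so the common denominator
    can be cleared.\<close>
  moreover have "br u (J u) + (1 / (1 - t\<^sup>2)) *\<^sub>R (br v (J v) - t *\<^sub>R br (J u) (J v) + (t * t) *\<^sub>R br u (J u))
     = (1 / (1 - t\<^sup>2)) *\<^sub>R (br u (J u) + br v (J v) - t *\<^sub>R br (J u) (J v))"
  proof -
    have "br u (J u) = (1 / (1 - t\<^sup>2)) *\<^sub>R ((1 - t\<^sup>2) *\<^sub>R br u (J u))" using t by simp
    then show ?thesis by (simp add: power2_eq_square algebra_simps)
  qed
  ultimately have "br u (J u) + br v (J v) - t *\<^sub>R br (J u) (J v) = 0" using t by simp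
  then have "t *\<^sub>R br (J u) (J v) = br u (J u) + br v (J v)" by simp
  then have "br (J u) u + br (J v) v + t *\<^sub>R br (J u) (J v) = 0"
    unfolding bracket_anticommute[of "J u" u] bracket_anticommute[of "J v" v]
    by (simp add: add_eq_0_iff2)
  with frame t show ?thesis using that by blast
qed

end

section \<open>Skewness from a trace identity\<close>

context hermitian
begin

text \<open>The trace of the hypothesis over \<open>S\<close> is twice the sum of the squared norms of the symmetric parts of
  \<open>P\<close> and \<open>Q\<close>.\<close>

lemma skew_of_trace_identity:
  assumes S: "subspace S" "\<And>x. x \<in> S \<Longrightarrow> J x \<in> S"
    and R: "linear P" "linear Q" "P ` S \<subseteq> S" "Q ` S \<subseteq> S"
    and eq: "\<And>x. x \<in> S \<Longrightarrow> g (P (P x)) x + g (P x) (P x) + g (Q (Q x)) x + g (Q x) (Q x) = 0"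
    and xy: "x \<in> S" "y \<in> S"
  shows "g (P x) y = - g x (P y)" "g (Q x) y = - g x (Q y)"
proof -
  obtain E where E: "unitary_basis S E" using ex_unitary_basis[OF S] by blast
  have JS: "J ` S \<subseteq> S" using S(2) by blast
  define B where "B = E \<union> J ` E"
  note B = unitary_basis_orthonormal[OF E JS, folded B_def]
  define m where "m R b c = g (R b) c" for R :: "'a \<Rightarrow> 'a" and b c
  have tr: "(\<Sum>b\<in>B. g (R (R b)) b + g (R b) (R b)) = (\<Sum>b\<in>B. \<Sum>c\<in>B. (m R b c + m R c b)\<^sup>2) / 2"
    if R: "linear R" "R ` S \<subseteq> S" for R
  proof -
    have "g (R (R b)) b = (\<Sum>c\<in>B. m R b c * m R c b) \<and> g (R b) (R b) = (\<Sum>c\<in>B. m R b c * m R b c)" if b: "b \<in> B" for b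
    proof -
      have Rb: "R b = (\<Sum>c\<in>B. m R b c *\<^sub>R c)" using B(2) B(4)[of "R b"] b R(2) unfolding m_def by blast
      have "R (R b) = (\<Sum>c\<in>B. m R b c *\<^sub>R R c)"
        by (subst Rb) (simp add: linear_sum[OF R(1)] linear_scale[OF R(1)])
      then have "g (R (R b)) b = (\<Sum>c\<in>B. m R b c * m R c b)" by (simp add: g_sum_left m_def)
      moreover have "g (R b) (R b) = (\<Sum>c\<in>B. m R b c * g (R b) c)"
        by (subst (2) Rb) (simp add: g_sum_right)
      ultimately show ?thesis by (simp add: m_def)
    qed
    then have "(\<Sum>b\<in>B. g (R (R b)) b + g (R b) (R b)) = (\<Sum>b\<in>B. \<Sum>c\<in>B. m R b c * m R c b) + (\<Sum>b\<in>B. \<Sum>c\<in>B. (m R b c)\<^sup>2)"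
      by (simp add: sum.distrib power2_eq_square)
    \<comment> \<open>Exchanging \<open>b\<close> and \<open>c\<close> in one half of the squares
      completes the binomial \<open>(m R b c + m R c b)\<^sup>2\<close>.\<close>
    moreover have "(\<Sum>b\<in>B. \<Sum>c\<in>B. (m R b c)\<^sup>2) = (\<Sum>b\<in>B. \<Sum>c\<in>B. (m R c b)\<^sup>2)" by (rule sum.swap)
    ultimately show ?thesis
      by (simp add: power2_sum sum.distrib sum_distrib_left[symmetric] mult.assoc)
  qed
  have "(\<Sum>b\<in>B. g (P (P b)) b + g (P b) (P b) + g (Q (Q b)) b + g (Q b) (Q b)) = 0"
    using B(2) eq by (intro sum.neutral) blast
  then have "(\<Sum>b\<in>B. g (P (P b)) b + g (P b) (P b)) + (\<Sum>b\<in>B. g (Q (Q b)) b + g (Q b) (Q b)) = 0"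
    by (simp add: sum.distrib add_ac)
  then have "(\<Sum>b\<in>B. \<Sum>c\<in>B. (m P b c + m P c b)\<^sup>2) + (\<Sum>b\<in>B. \<Sum>c\<in>B. (m Q b c + m Q c b)\<^sup>2) = 0"
    unfolding tr[OF R(1,3)] tr[OF R(2,4)] by simp
  moreover have "(\<Sum>b\<in>B. \<Sum>c\<in>B. (m P b c + m P c b)\<^sup>2) \<ge> 0" "(\<Sum>b\<in>B. \<Sum>c\<in>B. (m Q b c + m Q c b)\<^sup>2) \<ge> 0"
    by (auto intro!: sum_nonneg)
  ultimately have z: "(\<Sum>b\<in>B. \<Sum>c\<in>B. (m P b c + m P c b)\<^sup>2) = 0" "(\<Sum>b\<in>B. \<Sum>c\<in>B. (m Q b c + m Q c b)\<^sup>2) = 0"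
    by linarith+
  have skew: "g (R x) y = - g x (R y)" if R: "linear R" and z: "(\<Sum>b\<in>B. \<Sum>c\<in>B. (m R b c + m R c b)\<^sup>2) = 0" for R
  proof -
    have anti: "m R b c = - m R c b" if "b \<in> B" "c \<in> B" for b c
    proof -
      have "(\<Sum>c\<in>B. (m R b c + m R c b)\<^sup>2) = 0"
        using z that(1) by (subst (asm) sum_nonneg_eq_0_iff) (auto intro!: sum_nonneg simp: B(1))
      then have "(m R b c + m R c b)\<^sup>2 = 0"
        using that(2) by (subst (asm) sum_nonneg_eq_0_iff) (auto simp: B(1))
      then show ?thesis by simp
    qed
    have Rs: "R z = (\<Sum>b\<in>B. g z b *\<^sub>R R b)" if "z \<in> S" for z
      by (subst B(4)[OF that]) (simp add: linear_sum[OF R] linear_scale[OF R])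
    have "g (R x) y = g (\<Sum>b\<in>B. g x b *\<^sub>R R b) (\<Sum>c\<in>B. g y c *\<^sub>R c)"
      using Rs[OF xy(1)] B(4)[OF xy(2)] by simp
    also have "\<dots> = (\<Sum>b\<in>B. \<Sum>c\<in>B. g x b * (g y c * m R b c))"
      by (simp only: g_sum_left g_bilinear) (simp add: g_sum_right m_def sum_distrib_left)
    also have "\<dots> = (\<Sum>b\<in>B. \<Sum>c\<in>B. - (g x b * (g y c * m R c b)))"
    proof (intro sum.cong refl)
      fix b c assume "b \<in> B" "c \<in> B"
      from anti[OF this] show "g x b * (g y c * m R b c) = - (g x b * (g y c * m R c b))" by simp
    qed
    also have "\<dots> = - (\<Sum>b\<in>B. \<Sum>c\<in>B. g x b * (g y c * g b (R c)))"
      by (simp only: sum_negf m_def g_commute[of "R _"])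
    also have "\<dots> = - g (\<Sum>b\<in>B. g x b *\<^sub>R b) (\<Sum>c\<in>B. g y c *\<^sub>R R c)"
      by (simp only: g_sum_left g_bilinear) (simp add: g_sum_right sum_distrib_left)
    also have "\<dots> = - g x (R y)" using Rs[OF xy(2)] B(4)[OF xy(1)] by simp
    finally show ?thesis .
  qed
  show "g (P x) y = - g x (P y)" "g (Q x) y = - g x (Q y)"
    using skew[OF R(1) z(1)] skew[OF R(2) z(2)] .
qed

end

section \<open>The pluriclosed equation on \<open>W\<close>\<close>

locale hermitian_ideal = hermitian_lie J g br + abelian_ideal br J A for J g br A
begin

text \<open>This is \<open>pluriclosed_eq\<close> for \<open>x\<close> and \<open>w\<close>, divided
  by \<open>-2\<close>. The brackets of \<open>x\<close> with \<open>w\<close> and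
  \<open>J w\<close> and of \<open>w\<close> with \<open>J w\<close> vanish; the remaining three are
  \<open>- p\<close>, \<open>q\<close> and \<open>J q\<close>.\<close>

lemma pluriclosed_W:
  assumes pc: "pluriclosed br J g" and x: "x \<in> A" and w: "w \<in> W"
  shows "g (br (J (br (J x) x)) w) w + g (br (J x) (br (J x) w)) w + g (br (J x) w) (br (J x) w) = 0"
proof -
  define p q where "p = br (J x) x" and "q = br (J x) w"
  have mem: "p \<in> A" "q \<in> W" "w \<in> A" "J w \<in> A" "q \<in> A" "J q \<in> A" "J q \<in> W" "J w \<in> W"
    using x w bracket_in_A bracket_J_in_W[OF x w] J_W W_sub_A by (auto simp: p_def q_def)
  have br: "br x (J x) = - p" "br x w = 0" "br x (J w) = 0" "br (J x) (J w) = J q" "br w (J w) = 0"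
    "br (J x) w = q"
    using x w mem bracket_anticommute[of x "J x"] bracket_J_W[OF x w] by (auto simp: p_def q_def)
  have c1: "dw (J p) (J w) (J (J w)) = - 2 * g (br (J p) w) w"
    using bracket_J_W[OF mem(1) w] mem by (simp add: dw_def)
  have c2: "dw (J q) (J x) (J (J w)) = g (br (J x) q) w + g q q"
    using bracket_J_W[OF x mem(2)] bracket_anticommute[of "J q" "J x"] mem br by (simp add: dw_def)
  have c3: "dw (J (J q)) (J x) (J w) = - g (br (J x) q) w - g q q"
    using bracket_anticommute[of q "J x"] mem br by (simp add: dw_def)
  show ?thesis
    using pluriclosed_eq[OF pc, of x w] unfolding br p_def[symmetric] q_def[symmetric]
    using c1 c2 c3 by (simp add: dw_def)
qed

text \<open>By \<open>bracket_J_J\<close> the bracket of \<open>J u\<close> and \<open>J v\<close>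
  is \<open>J\<close> of an element of \<open>A\<close>. The relation therefore puts
  \<open>J\<close> of the sum into \<open>A\<close> as well.\<close>

lemma frame_relation_in_W:
  assumes "u \<in> A" "v \<in> A" and "br (J u) u + br (J v) v + t *\<^sub>R br (J u) (J v) = 0"
  shows "br (J u) u + br (J v) v \<in> W"
proof -
  let ?y = "br (J u) v - br (J v) u"
  have y: "?y \<in> A" using assms bracket_in_A subspace_diff[OF subspace_A] by blast
  have s: "br (J u) u + br (J v) v \<in> A" using assms bracket_in_A subspace_add[OF subspace_A] by blast
  have "br (J u) u + br (J v) v = J (- t *\<^sub>R ?y)"
    using assms(3) bracket_J_J[OF assms(1,2)] by (simp add: add_eq_0_iff2 algebra_simps)
  then have "J (br (J u) u + br (J v) v) = t *\<^sub>R ?y" by (simp only: J_J) simp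
  then show ?thesis using s subspace_scale[OF subspace_A y, of t] by (simp add: W_def del: J_linear)
qed

text \<open>Adding \<open>pluriclosed_W\<close> for \<open>u\<close> and \<open>v\<close> cancels
  the first terms: together they involve \<open>J\<close> of an element of \<open>W\<close>, which
  lies in \<open>A\<close> and acts on \<open>W\<close> by zero. What remains is the hypothesis of
  \<open>skew_of_trace_identity\<close>.\<close>

lemma bracket_skew:
  assumes pc: "pluriclosed br J g" and uv: "u \<in> A" "v \<in> A" and s: "br (J u) u + br (J v) v \<in> W"
    and w: "w \<in> W" "w' \<in> W"
  shows "g (br (J u) w) w' = - g w (br (J u) w')" "g (br (J v) w) w' = - g w (br (J v) w')"
proof -
  have lin: "linear (br (J u))" "linear (br (J v))" using bilinear_bracket by (auto simp: bilinear_def)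
  have inW: "br (J u) ` W \<subseteq> W" "br (J v) ` W \<subseteq> W" using bracket_J_in_W uv by auto
  have eq: "g (br (J u) (br (J u) x)) x + g (br (J u) x) (br (J u) x) + g (br (J v) (br (J v) x)) x + g (br (J v) x) (br (J v) x) = 0"
    if x: "x \<in> W" for x
  proof -
    have "br (J (br (J u) u + br (J v) v)) x = 0" by (intro bracket_A W_sub_A J_W s x)
    then have "br (J (br (J u) u)) x + br (J (br (J v) v)) x = 0" by simp
    then have "g (br (J (br (J u) u)) x + br (J (br (J v) v)) x) x = 0" by (simp only: g_bilinear)
    then have "g (br (J (br (J u) u)) x) x + g (br (J (br (J v) v)) x) x = 0" by (simp only: g_bilinear)
    then show ?thesis using pluriclosed_W[OF pc uv(1) x] pluriclosed_W[OF pc uv(2) x] by simp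
  qed
  show "g (br (J u) w) w' = - g w (br (J u) w')" "g (br (J v) w) w' = - g w (br (J v) w')"
    using skew_of_trace_identity[OF subspace_W J_W lin inW eq w] by auto
qed

end

section \<open>Structure constants and the adapted metric\<close>

locale framed_ideal = hermitian_ideal +
  fixes u v
  assumes frame: "frame u v"
begin

lemma u_A: "u \<in> A" and v_A: "v \<in> A"
  using frame by (simp_all add: frame_def)

definition comb :: "'a \<Rightarrow> real \<Rightarrow> real \<Rightarrow> real \<Rightarrow> real \<Rightarrow> 'a"
  where "comb w a b c d = w + a *\<^sub>R u + b *\<^sub>R v + c *\<^sub>R J u + d *\<^sub>R J v"

lemma comb_cases: obtains w a b c d where "w \<in> W" "x = comb w a b c d"
proof -
  have "\<exists>w\<in>W. \<exists>a b c d. x = comb w a b c d" using frame by (simp add: frame_def comb_def)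
  then show thesis using that by (elim bexE exE)
qed

lemma comb_add: "comb w a b c d + comb w' a' b' c' d' = comb (w + w') (a + a') (b + b') (c + c') (d + d')"
  and comb_diff: "comb w a b c d - comb w' a' b' c' d' = comb (w - w') (a - a') (b - b') (c - c') (d - d')"
  and comb_scale: "r *\<^sub>R comb w a b c d = comb (r *\<^sub>R w) (r * a) (r * b) (r * c) (r * d)"
  and J_comb: "J (comb w a b c d) = comb (J w) (- c) (- d) a b"
  by (simp_all add: comb_def algebra_simps)

lemma comb_inject:
  assumes "w \<in> W" "w' \<in> W" "comb w a b c d = comb w' a' b' c' d'"
  shows "w = w' \<and> a = a' \<and> b = b' \<and> c = c' \<and> d = d'"
proof -
  have "comb (w - w') (a - a') (b - b') (c - c') (d - d') = 0" using assms(3) by (simp flip: comb_diff)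
  moreover have "w - w' \<in> W" using assms subspace_W by (simp add: subspace_diff)
  ultimately have "a - a' = 0 \<and> b - b' = 0 \<and> c - c' = 0 \<and> d - d' = 0"
    using frame unfolding frame_def comb_def by blast
  then show ?thesis using assms(3) by (simp add: comb_def)
qed

definition coord :: "'a \<Rightarrow> 'a \<times> real \<times> real \<times> real \<times> real"
  where "coord x = (THE p. case p of (w, a, b, c, d) \<Rightarrow> w \<in> W \<and> x = comb w a b c d)"

lemma coord_comb: "w \<in> W \<Longrightarrow> coord (comb w a b c d) = (w, a, b, c, d)"
  unfolding coord_def by (rule the_equality) (auto dest!: comb_inject[rotated 2])

text \<open>The metric that agrees with \<open>g\<close> on \<open>W\<close> and makes
  \<open>u, v, J u, J v\<close> orthonormal and orthogonal to \<open>W\<close>. For a suitable frame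
  it is Kaehler; before that it serves to compute traces.\<close>

definition adapted :: "'a \<Rightarrow> 'a \<Rightarrow> real"
  where "adapted x y = (case coord x of (w, a, b, c, d) \<Rightarrow> case coord y of (w', a', b', c', d') \<Rightarrow>
    g w w' + a * a' + b * b' + c * c' + d * d')"

lemma adapted_comb:
  "w \<in> W \<Longrightarrow> w' \<in> W \<Longrightarrow> adapted (comb w a b c d) (comb w' a' b' c' d') = g w w' + a * a' + b * b' + c * c' + d * d'"
  by (simp add: adapted_def coord_comb)

lemma compatible_metric_adapted: "compatible_metric J adapted"
proof -
  note W = subspace_add[OF subspace_W] subspace_scale[OF subspace_W] J_W
  have sym: "adapted x y = adapted y x" for x y
  proof -
    obtain w a b c d where x: "w \<in> W" "x = comb w a b c d" by (rule comb_cases)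
    obtain w' a' b' c' d' where y: "w' \<in> W" "y = comb w' a' b' c' d'" by (rule comb_cases)
    show ?thesis using x y by (simp add: adapted_comb g_commute[of w w'])
  qed
  have add: "adapted (x + z) y = adapted x y + adapted z y" for x y z
  proof -
    obtain w a b c d where x: "w \<in> W" "x = comb w a b c d" by (rule comb_cases)
    obtain w' a' b' c' d' where y: "w' \<in> W" "y = comb w' a' b' c' d'" by (rule comb_cases)
    obtain w'' a'' b'' c'' d'' where z: "w'' \<in> W" "z = comb w'' a'' b'' c'' d''" by (rule comb_cases)
    show ?thesis using x y z by (simp add: adapted_comb comb_add W algebra_simps)
  qed
  have scale: "adapted (r *\<^sub>R x) y = r * adapted x y" for r x y
  proof -
    obtain w a b c d where x: "w \<in> W" "x = comb w a b c d" by (rule comb_cases)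
    obtain w' a' b' c' d' where y: "w' \<in> W" "y = comb w' a' b' c' d'" by (rule comb_cases)
    show ?thesis using x y by (simp add: adapted_comb comb_scale W algebra_simps)
  qed
  have J: "adapted (J x) (J y) = adapted x y" for x y
  proof -
    obtain w a b c d where x: "w \<in> W" "x = comb w a b c d" by (rule comb_cases)
    obtain w' a' b' c' d' where y: "w' \<in> W" "y = comb w' a' b' c' d'" by (rule comb_cases)
    show ?thesis using x y by (simp add: adapted_comb J_comb W)
  qed
  have pos: "adapted x x > 0" if "x \<noteq> 0" for x
  proof -
    obtain w a b c d where x: "w \<in> W" "x = comb w a b c d" by (rule comb_cases)
    have "adapted x x = g w w + a\<^sup>2 + b\<^sup>2 + c\<^sup>2 + d\<^sup>2" using x by (simp add: adapted_comb power2_eq_square)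
    moreover have "w \<noteq> 0 \<or> a \<noteq> 0 \<or> b \<noteq> 0 \<or> c \<noteq> 0 \<or> d \<noteq> 0" using that x by (auto simp: comb_def)
    then have "g w w > 0 \<or> a\<^sup>2 > 0 \<or> b\<^sup>2 > 0 \<or> c\<^sup>2 > 0 \<or> d\<^sup>2 > 0" using g_pos by auto
    moreover have "g w w \<ge> 0" "a\<^sup>2 \<ge> 0" "b\<^sup>2 \<ge> 0" "c\<^sup>2 \<ge> 0" "d\<^sup>2 \<ge> 0" using g_nonneg by auto
    ultimately show ?thesis by linarith
  qed
  have "bilinear adapted"
    unfolding bilinear_def using sym add scale by (auto intro!: linearI)
  then show ?thesis using sym pos J by (auto simp: compatible_metric_def)
qed

lemma comb_basis [simp]: "comb 0 1 0 0 0 = u" "comb 0 0 1 0 0 = v" "comb 0 0 0 1 0 = J u" "comb 0 0 0 0 1 = J v"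
  and comb_W [simp]: "comb w 0 0 0 0 = w"
  by (simp_all add: comb_def)

lemma zero_W [simp]: "0 \<in> W" by (rule subspace_0[OF subspace_W])

text \<open>For \<open>adapted\<close>, a unitary basis of \<open>W\<close> together with
  \<open>u\<close> and \<open>v\<close> is a unitary basis of the whole algebra.\<close>

lemma endo_trace_frame:
  assumes E: "unitary_basis W E" and f: "linear f"
  shows "endo_trace f = (\<Sum>e\<in>E. adapted (f e) e + adapted (f (J e)) (J e)) +
    adapted (f u) u + adapted (f (J u)) (J u) + adapted (f v) v + adapted (f (J v)) (J v)"
proof -
  interpret k: hermitian J adapted by (intro hermitian.intro J_props compatible_metric_adapted)
  have W: "adapted w w' = g w w'" if "w \<in> W" "w' \<in> W" for w w'
    using adapted_comb[OF that, of 0 0 0 0 0 0 0 0] by simp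
  let ?S1 = "{y \<in> UNIV. adapted y u = 0 \<and> adapted y (J u) = 0}"
  have kx: "adapted (comb w a b c d) u = a" "adapted (comb w a b c d) v = b"
    "adapted (comb w a b c d) (J u) = c" "adapted (comb w a b c d) (J v) = d" if "w \<in> W" for w a b c d
    using adapted_comb[OF that zero_W, of a b c d 1 0 0 0] adapted_comb[OF that zero_W, of a b c d 0 1 0 0]
      adapted_comb[OF that zero_W, of a b c d 0 0 1 0] adapted_comb[OF that zero_W, of a b c d 0 0 0 1] by simp_all
  have uu: "adapted u u = 1" "adapted v v = 1" "adapted v u = 0" "adapted v (J u) = 0"
    using kx[of 0 1 0 0 0] kx[of 0 0 1 0 0] by simp_all
  have S2: "{y \<in> ?S1. adapted y v = 0 \<and> adapted y (J v) = 0} = W"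
  proof (intro equalityI subsetI)
    fix x assume x: "x \<in> {y \<in> ?S1. adapted y v = 0 \<and> adapted y (J v) = 0}"
    obtain w a b c d where "w \<in> W" "x = comb w a b c d" by (rule comb_cases)
    then show "x \<in> W" using x kx by simp
  next
    fix w assume "w \<in> W"
    then show "w \<in> {y \<in> ?S1. adapted y v = 0 \<and> adapted y (J v) = 0}"
      using kx[of w 0 0 0 0] by simp
  qed
  have EW: "finite E" "E \<subseteq> W" using E by (auto simp: unitary_basis_def)
  have "k.unitary_basis W E"
    using E J_W unfolding unitary_basis_def k.unitary_basis_def by (auto simp: W subset_iff)
  moreover have "subspace ?S1" by (auto simp: subspace_def)
  moreover have "J x \<in> ?S1" if "x \<in> ?S1" for x using that by (simp add: k.g_J_left)
  ultimately have "k.unitary_basis ?S1 (insert v E)"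
    by (intro k.unitary_basis_extend) (use S2 uu in auto)
  then have UB: "k.unitary_basis UNIV (insert u (insert v E))"
    by (rule k.unitary_basis_extend) (use uu in auto)
  have "adapted w u = 0 \<and> adapted w v = 0" if "w \<in> W" for w
    using that unfolding S2[symmetric] by simp
  from this[of u] this[of v] have "u \<notin> insert v E" "v \<notin> E"
    using EW uu by auto
  then show ?thesis
    using k.endo_trace_unitary_basis[OF UB f] EW by simp
qed

text \<open>\<open>p\<close> and \<open>q\<close> are the coordinates of the class of
  \<open>x\<close> in the quotient of \<open>A\<close> by \<open>W\<close>.\<close>

definition cls :: "'a \<Rightarrow> real \<Rightarrow> real \<Rightarrow> bool"
  where "cls x p q \<longleftrightarrow> x - p *\<^sub>R u - q *\<^sub>R v \<in> W"

lemma cls_comb: "cls x p q \<longleftrightarrow> (\<exists>w\<in>W. x = comb w p q 0 0)"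
proof
  assume "cls x p q"
  then show "\<exists>w\<in>W. x = comb w p q 0 0"
    unfolding cls_def by (rule bexI[rotated]) (simp add: comb_def)
next
  assume "\<exists>w\<in>W. x = comb w p q 0 0"
  then obtain w where "w \<in> W" "x = comb w p q 0 0" by blast
  then show "cls x p q" by (simp add: cls_def comb_def)
qed

lemma cls_unique: "cls x p q \<Longrightarrow> cls x p' q' \<Longrightarrow> p = p' \<and> q = q'"
  unfolding cls_comb by (elim bexE) (metis comb_inject)

lemma cls_add: "cls x p q \<Longrightarrow> cls y r s \<Longrightarrow> cls (x + y) (p + r) (q + s)"
  and cls_diff: "cls x p q \<Longrightarrow> cls y r s \<Longrightarrow> cls (x - y) (p - r) (q - s)"
  and cls_scale: "cls x p q \<Longrightarrow> cls (c *\<^sub>R x) (c * p) (c * q)"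
proof -
  assume x: "cls x p q"
  show "cls (c *\<^sub>R x) (c * p) (c * q)"
    using subspace_scale[OF subspace_W x[unfolded cls_def], of c] by (simp add: cls_def algebra_simps)
  assume y: "cls y r s"
  show "cls (x + y) (p + r) (q + s)"
    using subspace_add[OF subspace_W x[unfolded cls_def] y[unfolded cls_def]] by (simp add: cls_def algebra_simps)
  show "cls (x - y) (p - r) (q - s)"
    using subspace_diff[OF subspace_W x[unfolded cls_def] y[unfolded cls_def]] by (simp add: cls_def algebra_simps)
qed

lemma cls_W: "cls x 0 0 \<longleftrightarrow> x \<in> W"
  by (simp add: cls_def)

text \<open>If \<open>c\<close> and \<open>d\<close> are the coefficients of \<open>J u\<close> and
  \<open>J v\<close> in \<open>x\<close>, then \<open>J\<close> maps
  \<open>c *\<^sub>R u + d *\<^sub>R v\<close> into \<open>A\<close>, so this vector lies in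
  \<open>W\<close> and independence gives \<open>c = d = 0\<close>.\<close>

lemma ex_cls: assumes "x \<in> A" obtains p q where "cls x p q"
proof -
  obtain w a b c d where x: "w \<in> W" "x = comb w a b c d" by (rule comb_cases)
  have cd: "c *\<^sub>R u + d *\<^sub>R v \<in> A" using u_A v_A subspace_A by (intro subspace_add subspace_scale)
  have "J (c *\<^sub>R u + d *\<^sub>R v) = x - (w + a *\<^sub>R u + b *\<^sub>R v)" using x by (simp add: comb_def)
  also have "\<dots> \<in> A"
    using x(1) assms u_A v_A W_sub_A subspace_A by (intro subspace_diff subspace_add subspace_scale) auto
  finally have "c *\<^sub>R u + d *\<^sub>R v \<in> W" using cd by (simp add: W_def)
  then have "comb (c *\<^sub>R u + d *\<^sub>R v) 0 0 0 0 = comb 0 c d 0 0 \<and> c *\<^sub>R u + d *\<^sub>R v \<in> W" by (simp add: comb_def)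
  then have "c = 0" "d = 0" using comb_inject[of "c *\<^sub>R u + d *\<^sub>R v" 0 0 0 0 0 c d 0 0] by auto
  then show ?thesis using that x cls_comb by blast
qed

text \<open>The operator of \<open>J x\<close> preserves \<open>W\<close>, so it acts on the
  quotient of \<open>A\<close> by \<open>W\<close>, through the matrix with columns
  \<open>(a, b)\<close> and \<open>(c, d)\<close>.\<close>

lemma cls_bracket:
  assumes "x \<in> A" "cls (br (J x) u) a b" "cls (br (J x) v) c d" and z: "cls z p q"
  shows "cls (br (J x) z) (p * a + q * c) (p * b + q * d)"
proof -
  obtain w where w: "w \<in> W" "z = w + p *\<^sub>R u + q *\<^sub>R v" using z by (auto simp: cls_comb comb_def)
  have "cls (br (J x) w) 0 0" using bracket_J_in_W[OF assms(1) w(1)] by (simp add: cls_W)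
  from cls_add[OF this cls_add[OF cls_scale[OF assms(2), of p] cls_scale[OF assms(3), of q]]]
  show ?thesis by (simp add: w(2) add.assoc)
qed

text \<open>The \<open>W\<close>-component \<open>w\<close> of \<open>y\<close> contributes
  \<open>br (J w) z\<close>, a bracket of two elements of \<open>A\<close>.\<close>

lemma bracket_J_cls:
  assumes "cls y r s" "z \<in> A"
  shows "br (J y) z = r *\<^sub>R br (J u) z + s *\<^sub>R br (J v) z"
proof -
  obtain w where w: "w \<in> W" "y = w + r *\<^sub>R u + s *\<^sub>R v" using assms by (auto simp: cls_comb comb_def)
  have "br (J w) z = 0" using J_W[OF w(1)] W_sub_A assms(2) by simp
  then show ?thesis by (simp add: w(2))
qed

lemma bracket_derivation: "br (br x y) z = br x (br y z) - br y (br x z)"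
  using jacobi[of x y z] bracket_anticommute[of "br x y" z] bracket_anticommute[of z x]
  by (simp add: algebra_simps add_eq_0_iff2)

lemma adapted_W: "w \<in> W \<Longrightarrow> w' \<in> W \<Longrightarrow> adapted w w' = g w w'"
  using adapted_comb[of w w' 0 0 0 0 0 0 0 0] by simp

lemma adapted_cls:
  assumes "cls x p q"
  shows "adapted x u = p" "adapted x v = q" "adapted (J x) (J u) = p" "adapted (J x) (J v) = q"
proof -
  interpret k: hermitian J adapted by (intro hermitian.intro J_props compatible_metric_adapted)
  obtain w where w: "w \<in> W" "x = comb w p q 0 0" using assms by (auto simp: cls_comb)
  show "adapted x u = p" "adapted x v = q"
    using adapted_comb[OF w(1) zero_W, of p q 0 0 1 0 0 0] adapted_comb[OF w(1) zero_W, of p q 0 0 0 1 0 0] w(2) by simp_all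
  then show "adapted (J x) (J u) = p" "adapted (J x) (J v) = q" by simp_all
qed

text \<open>Unimodularity and the Jacobi identity give the structure constants of the quotient by \<open>W\<close> the
  relation \<open>a\<^sup>2 + a d + 2 d\<^sup>2 + b\<^sup>2 - b e + 2 e\<^sup>2 = 0\<close>, whose left-hand side is positive definite.\<close>

lemma brackets_in_W:
  assumes uni: "unimodular br"
    and skew: "\<And>w. w \<in> W \<Longrightarrow> g (br (J u) w) w = 0" "\<And>w. w \<in> W \<Longrightarrow> g (br (J v) w) w = 0"
    and s: "br (J u) u + br (J v) v \<in> W"
  shows "br (J u) u \<in> W" "br (J u) v \<in> W" "br (J v) u \<in> W" "br (J v) v \<in> W"
proof -
  obtain a b where uu: "cls (br (J u) u) a b" using ex_cls[OF bracket_in_A(1)[OF u_A]] by blast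
  obtain c d where uv: "cls (br (J u) v) c d" using ex_cls[OF bracket_in_A(1)[OF v_A]] by blast
  obtain e f where vu: "cls (br (J v) u) e f" using ex_cls[OF bracket_in_A(1)[OF u_A]] by blast
  have vv: "cls (br (J v) v) (- a) (- b)"
    using cls_diff[OF s[folded cls_W] uu] by simp
  define y where "y = br (J u) v - br (J v) u"
  have y: "cls y (c - e) (d - f)" unfolding y_def by (rule cls_diff[OF uv vu])
  have Jy: "br (J u) (J v) = J y" "br (J v) (J u) = - J y"
    using bracket_J_J[OF u_A v_A] bracket_anticommute[of "J v" "J u"] by (simp_all add: y_def)
  obtain E where E: "unitary_basis W E" using ex_unitary_basis[OF subspace_W J_W] by blast
  then have EW: "E \<subseteq> W" by (auto simp: unitary_basis_def)
  have lin: "linear (br x)" for x using bilinear_bracket by (auto simp: bilinear_def)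
  interpret k: hermitian J adapted by (intro hermitian.intro J_props compatible_metric_adapted)
  \<comment> \<open>The operators are skew on \<open>W\<close>, so their traces come from the frame
    vectors alone.\<close>
  have z: "(\<Sum>e\<in>E. adapted (br (J x) e) e + adapted (br (J x) (J e)) (J e)) = 0" if "x = u \<or> x = v" for x
  proof (intro sum.neutral ballI)
    fix e assume "e \<in> E"
    then have e: "e \<in> W" using EW by auto
    have x: "x \<in> A" using that u_A v_A by auto
    have "adapted (br (J x) e') e' = 0" if "e' \<in> W" for e'
      using adapted_W[OF bracket_J_in_W[OF x that] that] skew that \<open>x = u \<or> x = v\<close> by auto
    from this[OF e] this[OF J_W[OF e]]
    show "adapted (br (J x) e) e + adapted (br (J x) (J e)) (J e) = 0" by (simp only: add_0)
  qed
  have "endo_trace (br (J u)) = a + 2 * d - f"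
    unfolding endo_trace_frame[OF E lin] using z[of u] Jy
      adapted_cls[OF uu] adapted_cls[OF uv] adapted_cls[OF y] by (simp add: bracket_self)
  moreover have "endo_trace (br (J v)) = 2 * e - c - b"
    unfolding endo_trace_frame[OF E lin] using z[of v] Jy
      adapted_cls[OF vu] adapted_cls[OF vv] adapted_cls[OF y] by (simp add: bracket_self)
  ultimately have tr: "f = a + 2 * d" "c = 2 * e - b" using uni by (simp_all add: unimodular_def)
  \<comment> \<open>The bracket of \<open>J u\<close> and \<open>J v\<close> is \<open>J y\<close>,
    so the commutator of the two operators on \<open>A\<close> is determined by the class of
    \<open>y\<close>.\<close>
  have jac: "(c - e) *\<^sub>R br (J u) z + (d - f) *\<^sub>R br (J v) z = br (J u) (br (J v) z) - br (J v) (br (J u) z)" if "z \<in> A" for z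
    using bracket_derivation[of "J u" "J v" z] Jy bracket_J_cls[OF y that] by simp
  note Ju = cls_bracket[OF u_A uu uv] and Jv = cls_bracket[OF v_A vu vv]
  \<comment> \<open>The \<open>v\<close>-coefficient of the Jacobi identity on \<open>u\<close>; in
    \<open>2\<close> it is the \<open>u\<close>-coefficient on \<open>v\<close>.\<close>
  have 1: "(c - e) * b + (d - f) * f = e * b + f * d - (a * f + b * (- b))"
    using cls_unique[OF cls_diff[OF Ju[OF vu] Jv[OF uu]]
      cls_add[OF cls_scale[OF uu, of "c - e"] cls_scale[OF vu, of "d - f"], unfolded jac[OF u_A]]] by simp
  have 2: "(c - e) * c + (d - f) * (- a) = (- a) * a + (- b) * c - (c * e + d * (- a))"
    using cls_unique[OF cls_diff[OF Ju[OF vv] Jv[OF uv]]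
      cls_add[OF cls_scale[OF uv, of "c - e"] cls_scale[OF vv, of "d - f"], unfolded jac[OF v_A]]] by simp
  have 3: "a\<^sup>2 + e * (2 * e - b) = 0" using 2 unfolding tr by (simp add: power2_eq_square algebra_simps)
  have 4: "b\<^sup>2 + d * (a + 2 * d) = 0" using 1 unfolding tr by (simp add: power2_eq_square algebra_simps)
  \<comment> \<open>The sum of \<open>3\<close> and \<open>4\<close> after completing
    squares.\<close>
  have "(a + d / 2)\<^sup>2 + 7 / 4 * d\<^sup>2 + (b - e / 2)\<^sup>2 + 7 / 4 * e\<^sup>2 = 0"
    using 3 4 by (simp add: power2_eq_square algebra_simps)
  moreover have "(a + d / 2)\<^sup>2 \<ge> 0" "d\<^sup>2 \<ge> 0" "(b - e / 2)\<^sup>2 \<ge> 0" "e\<^sup>2 \<ge> 0" by auto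
  ultimately have "d\<^sup>2 = 0" "e\<^sup>2 = 0" "(a + d / 2)\<^sup>2 = 0" "(b - e / 2)\<^sup>2 = 0" by linarith+
  then have "a = 0" "b = 0" "d = 0" "e = 0" "c = 0" "f = 0" using tr by auto
  then show "br (J u) u \<in> W" "br (J u) v \<in> W" "br (J v) u \<in> W" "br (J v) v \<in> W"
    using uu uv vu vv by (simp_all add: cls_W)
qed

text \<open>Only the operators of \<open>J u\<close> and \<open>J v\<close> on \<open>W\<close> are
  left in the bracket. They are skew and commute with \<open>J\<close>, so their composites with
  \<open>J\<close> are symmetric, and the six terms of the differential cancel in pairs.\<close>

lemma adapted_kaehler:
  assumes skew: "\<And>w w'. w \<in> W \<Longrightarrow> w' \<in> W \<Longrightarrow> g (br (J u) w) w' = - g w (br (J u) w')"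
      "\<And>w w'. w \<in> W \<Longrightarrow> w' \<in> W \<Longrightarrow> g (br (J v) w) w' = - g w (br (J v) w')"
    and zero: "br (J u) u = 0" "br (J u) v = 0" "br (J v) u = 0" "br (J v) v = 0"
  shows "kaehler br J adapted"
proof -
  interpret k: hermitian_lie J adapted br
    by (intro hermitian_lie.intro hermitian.intro J_props compatible_metric_adapted) unfold_locales
  define \<rho> where "\<rho> c d w = c *\<^sub>R br (J u) w + d *\<^sub>R br (J v) w" for c d w
  have \<rho>_W: "\<rho> c d w \<in> W" if "w \<in> W" for c d w
    using bracket_J_in_W[OF u_A that] bracket_J_in_W[OF v_A that] subspace_W
    by (auto simp: \<rho>_def intro: subspace_add subspace_scale)
  have \<rho>_skew: "g (J (\<rho> c d w)) w' = g (J (\<rho> c d w')) w" if "w \<in> W" "w' \<in> W" for c d w w'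
  proof -
    have "g (J (\<rho> c d w)) w' = - g (\<rho> c d w) (J w')" by (rule g_J_left)
    also have "\<dots> = g w (\<rho> c d (J w'))" using skew that J_W by (simp add: \<rho>_def)
    also have "\<rho> c d (J w') = J (\<rho> c d w')"
      using bracket_J_W[OF u_A that(2)] bracket_J_W[OF v_A that(2)] by (simp add: \<rho>_def)
    finally show ?thesis by (simp add: g_commute)
  qed
  have br_comb: "br (comb w a b c d) (comb w' a' b' c' d') = \<rho> c d w' - \<rho> c' d' w" if "w \<in> W" "w' \<in> W" for w a b c d w' a' b' c' d'
  proof -
    have "br (J u) (J v) = 0" "br (J v) (J u) = 0"
      using bracket_J_J[OF u_A v_A] bracket_J_J[OF v_A u_A] zero by simp_all
    moreover have "br u (J u) = 0" "br u (J v) = 0" "br v (J u) = 0" "br v (J v) = 0"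
      using zero bracket_anticommute[of _ "J u"] bracket_anticommute[of _ "J v"] by simp_all
    moreover have "br w (J u) = - br (J u) w" "br w (J v) = - br (J v) w"
      by (rule bracket_anticommute)+
    ultimately show ?thesis
      using that W_sub_A u_A v_A zero by (simp add: comb_def \<rho>_def bracket_self)
  qed
  have kW: "adapted (J w) (comb w' a' b' c' d') = g (J w) w'" if "w \<in> W" "w' \<in> W" for w w' a' b' c' d'
    using adapted_comb[OF J_W[OF that(1)] that(2), of 0 0 0 0] by simp
  have "k.dw x y z = 0" for x y z
  proof -
    obtain w1 a1 b1 c1 d1 where x: "w1 \<in> W" "x = comb w1 a1 b1 c1 d1" by (rule comb_cases)
    obtain w2 a2 b2 c2 d2 where y: "w2 \<in> W" "y = comb w2 a2 b2 c2 d2" by (rule comb_cases)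
    obtain w3 a3 b3 c3 d3 where z: "w3 \<in> W" "z = comb w3 a3 b3 c3 d3" by (rule comb_cases)
    have m: "\<rho> c d w - \<rho> c' d' w' \<in> W" if "w \<in> W" "w' \<in> W" for c d c' d' w w'
      using \<rho>_W that subspace_W by (auto intro: subspace_diff)
    have "k.dw x y z = - g (J (\<rho> c1 d1 w2 - \<rho> c2 d2 w1)) w3 + g (J (\<rho> c1 d1 w3 - \<rho> c3 d3 w1)) w2
        - g (J (\<rho> c2 d2 w3 - \<rho> c3 d3 w2)) w1"
      unfolding k.dw_def x(2) y(2) z(2) br_comb[OF x(1) y(1)] br_comb[OF x(1) z(1)] br_comb[OF y(1) z(1)]
      using x y z m by (simp only: kW)
    also have "\<dots> = 0"
      using \<rho>_skew[OF x(1) y(1), of c3 d3] \<rho>_skew[OF x(1) z(1), of c2 d2] \<rho>_skew[OF y(1) z(1), of c1 d1] by simp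
    finally show ?thesis .
  qed
  then have 3: "ce_d br (kaehler_form J adapted) xs = 0" if l: "length xs = 3" for xs
    using list_3_cases[OF l] k.ce_d_kaehler_form_3 by (metis of_real_0)
  have "ce_d br (kaehler_form J adapted) xs = 0" for xs
  proof (cases "length xs = 3")
    case False
    have "kaehler_form J adapted (br (xs ! i) (xs ! j) # nths xs (- {i, j})) = 0" if "i < j" "j < length xs" for i j
    proof (rule k.kaehler_form_deg)
      have "{l. l < length xs \<and> l \<in> - {i, j}} = {..<length xs} - {i, j}" by auto
      then have "length (nths xs (- {i, j})) = length xs - 2"
        using that by (simp add: length_nths card_Diff_subset)
      then show "length (br (xs ! i) (xs ! j) # nths xs (- {i, j})) \<noteq> 2" using False that by simp
    qed
    then show ?thesis unfolding ce_d_def by (intro sum.neutral ballI) simp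
  qed (rule 3)
  then show ?thesis by (simp add: kaehler_def fun_eq_iff)
qed

end

section \<open>The common kernel of the two operators and the change of frame\<close>

context framed_ideal
begin

definition W0 :: "'a set"
  where "W0 = {w \<in> W. br (J u) w = 0 \<and> br (J v) w = 0}"

lemma W0_sub_W: "k \<in> W0 \<Longrightarrow> k \<in> W"
  by (simp add: W0_def)

lemma subspace_W0: "subspace W0"
  using subspace_W by (auto simp: W0_def subspace_def)

lemma J_W0: "k \<in> W0 \<Longrightarrow> J k \<in> W0"
  using J_W bracket_J_W[OF u_A] bracket_J_W[OF v_A] by (simp add: W0_def)

text \<open>Elements of \<open>W0\<close> are central: they commute with \<open>A\<close>, which
  contains \<open>W\<close>, \<open>u\<close> and \<open>v\<close>, and are killed by
  \<open>J u\<close> and \<open>J v\<close>.\<close>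

lemma bracket_W0:
  assumes "k \<in> W0" shows "br z k = 0" "br k z = 0"
proof -
  obtain w a b c d where "w \<in> W" "z = comb w a b c d" by (rule comb_cases)
  then show "br z k = 0" using assms W_sub_A u_A v_A by (simp add: W0_def comb_def)
  then show "br k z = 0" using bracket_anticommute[of k z] by simp
qed

text \<open>\<open>J k\<close> is central, so of the three brackets in \<open>dw\<close> only that
  of \<open>p\<close> and \<open>q\<close> is left.\<close>

lemma dw_W0: "k \<in> W0 \<Longrightarrow> dw (J k) p q = - g (br p q) k"
  using bracket_W0[OF J_W0] by (simp add: dw_def)

text \<open>This is \<open>pluriclosed_eq\<close> for \<open>x\<close> and \<open>y\<close>; all
  brackets lie in \<open>W0\<close>, so \<open>dw_W0\<close> evaluates each term.\<close>

lemma pluriclosed_W0: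
  assumes pc: "pluriclosed br J g" and x: "x \<in> A" and y: "y \<in> A"
    and W0: "br (J x) x \<in> W0" "br (J x) y \<in> W0" "br (J y) x \<in> W0" "br (J y) y \<in> W0"
  shows "2 * g (br (J x) x) (br (J y) y) = g (br (J x) y) (br (J x) y) + g (br (J y) x) (br (J y) x)
    + g (br (J x) y - br (J y) x) (br (J x) y - br (J y) x)"
proof -
  define p q r s where "p = br (J x) x" and "q = br (J x) y" and "r = br (J y) x" and "s = br (J y) y"
  have mem: "p \<in> W0" "q \<in> W0" "r \<in> W0" "s \<in> W0" using W0 by (simp_all add: p_def q_def r_def s_def)
  have qr: "q - r \<in> W0" using mem subspace_W0 by (simp add: subspace_diff)
  have br: "br (J x) x = p" "br (J x) y = q" "br (J y) x = r" "br (J y) y = s"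
    "br x (J x) = - p" "br y (J x) = - q" "br x (J y) = - r" "br y (J y) = - s" "br (J x) (J y) = J (q - r)"
    "br x y = 0"
    using x y bracket_anticommute[of x "J x"] bracket_anticommute[of x "J y"] bracket_anticommute[of y "J x"]
      bracket_anticommute[of y "J y"] bracket_J_J[OF x y] by (simp_all add: p_def q_def r_def s_def del: J_linear)
  have "dw (J p) (J y) (J (J y)) = g s p" "dw (J r) (J (J x)) (J y) = - g r r" "dw (J q) (J x) (J (J y)) = g q q"
    "dw (J s) (J x) (J (J x)) = g p s"
    unfolding dw_W0[OF mem(1)] dw_W0[OF mem(2)] dw_W0[OF mem(3)] dw_W0[OF mem(4)] J_J
      bilinear_rneg[OF bilinear_bracket] bilinear_lneg[OF bilinear_bracket] br g_J
    by (simp_all only: g_bilinear minus_minus)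
  moreover have "dw (J (J (q - r))) (J x) (J y) = - g (q - r) (q - r)"
    unfolding dw_W0[OF J_W0[OF qr]] br by (simp only: g_J)
  moreover have "dw 0 x y = 0" by (simp add: dw_def)
  ultimately show ?thesis
    using pluriclosed_eq[OF pc, of x y] g_commute[of s p] unfolding br by simp
qed

context
  assumes skew_on_W: "\<forall>w\<in>W. \<forall>w'\<in>W. g (br (J u) w) w' = - g w (br (J u) w')"
      "\<forall>w\<in>W. \<forall>w'\<in>W. g (br (J v) w) w' = - g w (br (J v) w')"
    and in_W: "br (J u) u \<in> W" "br (J u) v \<in> W" "br (J v) u \<in> W" "br (J v) v \<in> W"
begin

lemmas skew = skew_on_W(1)[rule_format] skew_on_W(2)[rule_format]

text \<open>The bracket of \<open>J u\<close> and \<open>J v\<close> is \<open>J\<close> of an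
  element of \<open>W\<close>, hence in \<open>A\<close>, and so acts trivially on
  \<open>A\<close>.\<close>

lemma bracket_commute:
  assumes "z \<in> A" shows "br (J u) (br (J v) z) = br (J v) (br (J u) z)"
proof -
  have y: "br (J u) v - br (J v) u \<in> W" using in_W subspace_W by (simp add: subspace_diff)
  have "br (br (J u) (J v)) z = 0"
    unfolding bracket_J_J[OF u_A v_A] by (rule bracket_A[OF W_sub_A[OF J_W[OF y]] assms])
  then show ?thesis using bracket_derivation[of "J u" "J v" z] by simp
qed

text \<open>On \<open>W\<close> the operator \<open>N\<close>, the sum of the squares of the two
  skew operators, is symmetric and negative semidefinite with kernel \<open>W0\<close>, so
  \<open>W\<close> is the sum of this kernel and the image of \<open>N\<close>.\<close>

lemma W0_decomposition:
  assumes z: "z \<in> W"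
  obtains k w where "k \<in> W0" "w \<in> W" "z = k + (br (J u) (br (J u) w) + br (J v) (br (J v) w))"
proof -
  define N where "N w = br (J u) (br (J u) w) + br (J v) (br (J v) w)" for w
  note inW = bracket_J_in_W[OF u_A] bracket_J_in_W[OF v_A]
  have N_W: "w \<in> W \<Longrightarrow> N w \<in> W" for w using inW subspace_W by (simp add: N_def subspace_add)
  have N_J: "w \<in> W \<Longrightarrow> N (J w) = J (N w)" for w
    using inW bracket_J_W[OF u_A] bracket_J_W[OF v_A] by (simp add: N_def)
  have N_sym: "g (N w) w' = g w (N w')" if "w \<in> W" "w' \<in> W" for w w'
    using inW skew that by (simp add: N_def)
  have "linear N" by (rule linearI) (simp_all add: N_def algebra_simps)
  then have "subspace (N ` W)" using subspace_W by (rule linear_subspace_image)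
  moreover have "J x \<in> N ` W" if "x \<in> N ` W" for x using that N_J J_W by (auto simp: image_iff) metis
  ultimately obtain p where p: "p \<in> N ` W" "\<And>s. s \<in> N ` W \<Longrightarrow> g (z - p) s = 0"
    using ex_orthogonal_projection by blast
  let ?q = "z - p"
  have q: "?q \<in> W" using z p(1) N_W subspace_W by (auto intro: subspace_diff)
  \<comment> \<open>The vector \<open>N (N ?q)\<close> is in the image of \<open>N\<close>, to which
    \<open>?q\<close> is orthogonal; symmetry turns this into \<open>N ?q = 0\<close>.\<close>
  have "g ?q (N (N ?q)) = 0" using p(2) N_W[OF q] by blast
  then have "g (N ?q) (N ?q) = 0" using N_sym[OF q N_W[OF q]] by simp
  then have "g (N ?q) ?q = 0" by simp
  then have "g (br (J u) ?q) (br (J u) ?q) + g (br (J v) ?q) (br (J v) ?q) = 0"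
    using skew(1)[OF inW(1)[OF q] q] skew(2)[OF inW(2)[OF q] q] unfolding N_def by (simp only: g_bilinear)
  then have "g (br (J u) ?q) (br (J u) ?q) = 0" "g (br (J v) ?q) (br (J v) ?q) = 0"
    using g_nonneg[of "br (J u) ?q"] g_nonneg[of "br (J v) ?q"] by linarith+
  then have "?q \<in> W0" unfolding g_eq_0_iff using q by (simp add: W0_def)
  moreover from p(1) obtain w where "w \<in> W" "p = N w" by auto
  ultimately show ?thesis using that[of ?q w] by (simp add: N_def)
qed

text \<open>\<open>(\<beta>\<^sub>1, \<beta>\<^sub>2)\<close> is a cocycle for the commuting skew operators \<open>ad (Ju)\<close> and \<open>ad (Jv)\<close> on \<open>W\<close>;
  up to their common kernel it is a coboundary.\<close>

lemma ex_coboundary: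
  assumes "\<beta>\<^sub>1 \<in> W" "\<beta>\<^sub>2 \<in> W" and eq: "br (J u) \<beta>\<^sub>2 = br (J v) \<beta>\<^sub>1"
  obtains \<psi> where "\<psi> \<in> W" "\<beta>\<^sub>1 - br (J u) \<psi> \<in> W0" "\<beta>\<^sub>2 - br (J v) \<psi> \<in> W0"
proof -
  note inW = bracket_J_in_W[OF u_A] bracket_J_in_W[OF v_A]
  obtain k\<^sub>1 w\<^sub>1 where 1: "k\<^sub>1 \<in> W0" "w\<^sub>1 \<in> W" "\<beta>\<^sub>1 = k\<^sub>1 + (br (J u) (br (J u) w\<^sub>1) + br (J v) (br (J v) w\<^sub>1))"
    by (rule W0_decomposition[OF assms(1)])
  obtain k\<^sub>2 w\<^sub>2 where 2: "k\<^sub>2 \<in> W0" "w\<^sub>2 \<in> W" "\<beta>\<^sub>2 = k\<^sub>2 + (br (J u) (br (J u) w\<^sub>2) + br (J v) (br (J v) w\<^sub>2))"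
    by (rule W0_decomposition[OF assms(2)])
  \<comment> \<open>The error term for the \<open>?\<psi>\<close> below. Applied to the
    decompositions, \<open>eq\<close> says that the sum of the squares of the two operators kills
    \<open>x\<close>, hence both operators do.\<close>
  define x where "x = br (J u) w\<^sub>2 - br (J v) w\<^sub>1"
  have xW: "x \<in> W" using inW 1 2 subspace_W by (simp add: x_def subspace_diff)
  have com: "br (J v) (br (J u) w) = br (J u) (br (J v) w)" if "w \<in> W" for w
    using bracket_commute W_sub_A that by simp
  have "br (J u) (br (J u) x) + br (J v) (br (J v) x) = 0"
    using eq unfolding 1(3) 2(3) x_def
    using bracket_W0(1)[OF 1(1)] bracket_W0(1)[OF 2(1)] com inW 1(2) 2(2) by (simp add: algebra_simps)
  then have "g (br (J u) (br (J u) x) + br (J v) (br (J v) x)) x = 0" by (simp only: g_bilinear)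
  then have "g (br (J u) x) (br (J u) x) + g (br (J v) x) (br (J v) x) = 0"
    using skew(1)[OF inW(1)[OF xW] xW] skew(2)[OF inW(2)[OF xW] xW] by (simp only: g_bilinear)
  then have "g (br (J u) x) (br (J u) x) = 0" "g (br (J v) x) (br (J v) x) = 0"
    using g_nonneg[of "br (J u) x"] g_nonneg[of "br (J v) x"] by linarith+
  then have x0: "br (J u) x = 0" "br (J v) x = 0" by (simp_all only: g_eq_0_iff)
  \<comment> \<open>In the manner of Hodge theory, \<open>?\<psi>\<close> is the divergence of the
    pair \<open>(w\<^sub>1, w\<^sub>2)\<close>, and \<open>x\<close> is its curl.\<close>
  let ?\<psi> = "br (J u) w\<^sub>1 + br (J v) w\<^sub>2"
  show ?thesis
  proof
    show "?\<psi> \<in> W" using inW 1 2 subspace_W by (simp add: subspace_add)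
    have "\<beta>\<^sub>1 - br (J u) ?\<psi> = k\<^sub>1 - br (J v) x" using com[OF 2(2)] by (simp add: 1(3) x_def)
    then show "\<beta>\<^sub>1 - br (J u) ?\<psi> \<in> W0" using x0 1 by simp
    have "\<beta>\<^sub>2 - br (J v) ?\<psi> = k\<^sub>2 + br (J u) x" using com[OF 1(2)] by (simp add: 2(3) x_def)
    then show "\<beta>\<^sub>2 - br (J v) ?\<psi> \<in> W0" using x0 2 by simp
  qed
qed

lemma frame_shift:
  assumes "\<psi>\<^sub>1 \<in> W" "\<psi>\<^sub>2 \<in> W"
  shows "frame (u - \<psi>\<^sub>1) (v - \<psi>\<^sub>2)"
proof -
  let ?p = "\<lambda>a b c d. a *\<^sub>R \<psi>\<^sub>1 + b *\<^sub>R \<psi>\<^sub>2 + c *\<^sub>R J \<psi>\<^sub>1 + d *\<^sub>R J \<psi>\<^sub>2"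
  have p: "?p a b c d \<in> W" for a b c d
    using assms J_W subspace_W by (intro subspace_add subspace_scale) auto
  have eq: "w + a *\<^sub>R (u - \<psi>\<^sub>1) + b *\<^sub>R (v - \<psi>\<^sub>2) + c *\<^sub>R J (u - \<psi>\<^sub>1) + d *\<^sub>R J (v - \<psi>\<^sub>2) = comb (w - ?p a b c d) a b c d" for w a b c d
    by (simp add: comb_def algebra_simps)
  show ?thesis
    unfolding frame_def eq
  proof (intro conjI allI ballI impI)
    show "u - \<psi>\<^sub>1 \<in> A" "v - \<psi>\<^sub>2 \<in> A" using assms u_A v_A W_sub_A subspace_A by (auto intro: subspace_diff)
    fix x
    obtain w a b c d where x: "w \<in> W" "x = comb w a b c d" by (rule comb_cases)
    have "w + ?p a b c d \<in> W" using x p subspace_W by (simp add: subspace_add)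
    moreover have "x = comb (w + ?p a b c d - ?p a b c d) a b c d" using x by simp
    ultimately show "\<exists>w\<in>W. \<exists>a b c d. x = comb (w - ?p a b c d) a b c d" by blast
  next
    fix w a b c d assume w: "w \<in> W" and z: "comb (w - ?p a b c d) a b c d = 0"
    have "w - ?p a b c d \<in> W" using w p subspace_W by (simp add: subspace_diff)
    moreover have "comb (w - ?p a b c d) a b c d = comb 0 0 0 0 0" using z by simp
    ultimately have "a = 0 \<and> b = 0 \<and> c = 0 \<and> d = 0" using comb_inject[OF _ zero_W] by blast
    then show "a = 0" "b = 0" "c = 0" "d = 0" by auto
  qed
qed

end

text \<open>Skewness confines the brackets of the frame to \<open>W\<close>, and coboundaries move
  them into \<open>W0\<close>. There the balanced relation survives the change of frame and meets
  the pluriclosed equation.\<close>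

lemma ex_kaehler_metric:
  assumes uni: "unimodular br" and pc: "pluriclosed br J g"
    and rel: "br (J u) u + br (J v) v + t *\<^sub>R br (J u) (J v) = 0" and t: "t\<^sup>2 < 1"
  shows "\<exists>k. compatible_metric J k \<and> kaehler br J k"
proof -
  note s = frame_relation_in_W[OF u_A v_A rel]
  note skew = bracket_skew[OF pc u_A v_A s]
  have skew_on_W: "\<forall>w\<in>W. \<forall>w'\<in>W. g (br (J u) w) w' = - g w (br (J u) w')"
      "\<forall>w\<in>W. \<forall>w'\<in>W. g (br (J v) w) w' = - g w (br (J v) w')"
    using skew by blast+
  have diag: "w \<in> W \<Longrightarrow> g (br (J u) w) w = 0" "w \<in> W \<Longrightarrow> g (br (J v) w) w = 0" for w
    using skew[of w w] g_commute[of w] by simp_all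
  have in_W: "br (J u) u \<in> W" "br (J u) v \<in> W" "br (J v) u \<in> W" "br (J v) v \<in> W"
    by (rule brackets_in_W[OF uni _ _ s], simp_all only: diag)+
  \<comment> \<open>Since the operators commute, \<open>br (J u) z\<close> and
    \<open>br (J v) z\<close> form a cocycle for each \<open>z\<close> in \<open>A\<close>; it is
    made trivial up to \<open>W0\<close> for \<open>z = u\<close> and \<open>z = v\<close>.\<close>
  note com = bracket_commute[OF skew_on_W in_W]
  obtain \<psi>\<^sub>1 where 1: "\<psi>\<^sub>1 \<in> W" "br (J u) u - br (J u) \<psi>\<^sub>1 \<in> W0" "br (J v) u - br (J v) \<psi>\<^sub>1 \<in> W0"
    using ex_coboundary[OF skew_on_W in_W in_W(1,3) com[OF u_A]] by blast
  obtain \<psi>\<^sub>2 where 2: "\<psi>\<^sub>2 \<in> W" "br (J u) v - br (J u) \<psi>\<^sub>2 \<in> W0" "br (J v) v - br (J v) \<psi>\<^sub>2 \<in> W0"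
    using ex_coboundary[OF skew_on_W in_W in_W(2,4) com[OF v_A]] by blast
  define u' v' where "u' = u - \<psi>\<^sub>1" and "v' = v - \<psi>\<^sub>2"
  have "frame u' v'" unfolding u'_def v'_def by (rule frame_shift[OF skew_on_W in_W 1(1) 2(1)])
  then interpret f: framed_ideal J g br A u' v' by unfold_locales
  \<comment> \<open>\<open>J\<close> of an element of \<open>W\<close> commutes with
    \<open>A\<close>, so the shift leaves the two operators unchanged on \<open>A\<close>.\<close>
  have ad: "br (J u') z = br (J u) z" "br (J v') z = br (J v) z" if "z \<in> A" for z
    using that J_W[OF 1(1)] J_W[OF 2(1)] W_sub_A by (simp_all add: u'_def v'_def)
  have br: "br (J u') u' = br (J u) u - br (J u) \<psi>\<^sub>1" "br (J u') v' = br (J u) v - br (J u) \<psi>\<^sub>2"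
    "br (J v') u' = br (J v) u - br (J v) \<psi>\<^sub>1" "br (J v') v' = br (J v) v - br (J v) \<psi>\<^sub>2"
    using ad[OF f.u_A] ad[OF f.v_A] by (simp_all add: u'_def v'_def)
  note br_W0 = 1(2)[folded br] 2(2)[folded br] 1(3)[folded br] 2(3)[folded br]
  have W0_eq: "f.W0 = W0" using ad W_sub_A by (auto simp: W0_def f.W0_def)
  let ?d = "br (J u') v' - br (J v') u'"
  \<comment> \<open>The balanced expression of the shifted frame. It lies in \<open>W0\<close>; by
    the original relation it is also built from images of the two skew operators and
    \<open>J\<close> of such images, which are orthogonal to \<open>W0\<close>. Hence it
    vanishes.\<close>
  let ?r = "br (J u') u' + br (J v') v' + t *\<^sub>R J ?d"
  have rW0: "?r \<in> W0"
    by (intro subspace_add[OF subspace_W0] subspace_scale[OF subspace_W0] J_W0 subspace_diff[OF subspace_W0] br_W0)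
  have orth: "g (br (J u) \<psi>) k = 0" "g (br (J v) \<psi>) k = 0" if "\<psi> \<in> W" "k \<in> W0" for \<psi> k
    using skew[OF that(1) W0_sub_W[OF that(2)]] bracket_W0[OF that(2)] by simp_all
  have "?r = (br (J u) u + br (J v) v + t *\<^sub>R br (J u) (J v))
      - (br (J u) \<psi>\<^sub>1 + br (J v) \<psi>\<^sub>2 + t *\<^sub>R J (br (J u) \<psi>\<^sub>2 - br (J v) \<psi>\<^sub>1))"
    unfolding br bracket_J_J[OF u_A v_A] by (simp add: algebra_simps)
  then have r: "?r = - (br (J u) \<psi>\<^sub>1 + br (J v) \<psi>\<^sub>2 + t *\<^sub>R J (br (J u) \<psi>\<^sub>2 - br (J v) \<psi>\<^sub>1))"
    unfolding rel by simp
  have "g (- (br (J u) \<psi>\<^sub>1 + br (J v) \<psi>\<^sub>2 + t *\<^sub>R J (br (J u) \<psi>\<^sub>2 - br (J v) \<psi>\<^sub>1))) k = 0" if k: "k \<in> W0" for k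
    using orth[OF 1(1) k] orth[OF 2(1) k] orth[OF 1(1) J_W0[OF k]] orth[OF 2(1) J_W0[OF k]]
    by (simp add: g_J_left)
  from this[OF rW0] have r0: "?r = 0" unfolding r[symmetric] g_eq_0_iff .
  define a b c d where "a = br (J u') u'" and "b = br (J v') v'" and "c = br (J u') v'" and "d = br (J v') u'"
  have P: "2 * g a b = g c c + g d d + g (c - d) (c - d)"
    using f.pluriclosed_W0[OF pc f.u_A f.v_A] br_W0 unfolding W0_eq a_def b_def c_def d_def by blast
  have "a + b = (- t) *\<^sub>R J (c - d)" using r0 by (simp add: a_def b_def c_def d_def add_eq_0_iff2 del: J_linear)
  then have "g (a + b) (a + b) = g ((- t) *\<^sub>R J (c - d)) ((- t) *\<^sub>R J (c - d))" by (simp only:)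
  then have Q: "g a a + g b b + 2 * g a b = t\<^sup>2 * g (c - d) (c - d)"
    using g_commute[of b a] by (simp add: power2_eq_square algebra_simps del: J_linear)
  \<comment> \<open>\<open>R\<close> and \<open>P\<close> bound \<open>g (a + b) (a + b)\<close>
    below by \<open>2 * (g c c + g d d + g (c - d) (c - d))\<close>, while \<open>Q\<close> and
    \<open>t\<^sup>2 < 1\<close> bound it above by \<open>g (c - d) (c - d)\<close>; so everything
    vanishes.\<close>
  have R: "g a a + g b b - 2 * g a b \<ge> 0"
    using g_nonneg[of "a - b"] g_commute[of b a] by simp
  have nn: "g c c \<ge> 0" "g d d \<ge> 0" "g (c - d) (c - d) \<ge> 0" "g a a \<ge> 0" "g b b \<ge> 0" by (rule g_nonneg)+
  have "t\<^sup>2 * g (c - d) (c - d) \<le> 1 * g (c - d) (c - d)" by (rule mult_right_mono) (use t nn in auto)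
  then have "g (c - d) (c - d) = 0" "g c c = 0" "g d d = 0" using P Q R nn by linarith+
  moreover from this have "g a a + g b b = 0" using P Q by simp
  then have "g a a = 0" "g b b = 0" using nn by linarith+
  ultimately have "a = 0" "b = 0" "c = 0" "d = 0" by (simp_all only: g_eq_0_iff)
  moreover have "g (br (J u') w) w' = - g w (br (J u') w')" "g (br (J v') w) w' = - g w (br (J v') w')"
    if "w \<in> W" "w' \<in> W" for w w'
    using skew[OF that] ad W_sub_A that by simp_all
  ultimately have "kaehler br J f.adapted"
    by (intro f.adapted_kaehler) (simp_all add: a_def b_def c_def d_def)
  then show ?thesis using f.compatible_metric_adapted by blast
qed

end

theorem theorem2:
  fixes br :: "'a::euclidean_space \<Rightarrow> 'a \<Rightarrow> 'a"
    and \<aa> :: "'a set"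
    and J :: "'a \<Rightarrow> 'a"
  assumes "lie_algebra br"
    and "even DIM('a)"
    and "unimodular br"
    and "lie_ideal br \<aa>"
    and "abelian_on br \<aa>"
    and "dim \<aa> + 2 = DIM('a)"
    and "complex_structure br J"
    and "J ` \<aa> \<noteq> \<aa>"
    and "\<exists>g. compatible_metric J g \<and> balanced br J g"
    and "\<exists>g. compatible_metric J g \<and> pluriclosed br J g"
  shows "\<exists>g. compatible_metric J g \<and> kaehler br J g"
proof -
  obtain h g where h: "compatible_metric J h" "balanced br J h" and g: "compatible_metric J g" "pluriclosed br J g"
    using assms(9,10) by blast
  interpret abelian_ideal br J \<aa>
    using assms by (intro abelian_ideal.intro complex_lie_algebra.intro complex_lie_algebra_axioms.intro abelian_ideal_axioms.intro)
  obtain u v t where uv: "frame u v" "br (J u) u + br (J v) v + t *\<^sub>R br (J u) (J v) = 0" "t\<^sup>2 < 1"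
    by (rule ex_frame[OF assms(6,2,8) h(1) assms(3) h(2)])
  \<comment> \<open>From here on the metric is the pluriclosed one; of the balanced metric
    \<open>h\<close> only the relation in \<open>uv\<close> is kept.\<close>
  interpret hermitian J g by (intro hermitian.intro J_props g(1))
  interpret framed_ideal J g br \<aa> u v by unfold_locales (rule uv(1))
  show ?thesis by (rule ex_kaehler_metric[OF assms(3) g(2) uv(2,3)])
qed

end
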